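(* Let $P:\mathsf{DL}\to\mathsf{PS}$ and $CU:\mathsf{PS}\to\mathsf{DL}$ be the contravariant functors of Priestley duality, and let $\mathcal{K}:\mathsf{DL}\to\mathsf{DL}$ and $\mathcal{C}:\mathsf{PS}\to\mathsf{PS}$ be the endofunctors $L\mapsto L^{\Diamond\Box}$ and $X\mapsto\mathcal{C}(X)$. Then, with $\simeq$ denoting natural isomorphism of functors: (1) $P\circ\mathcal{K}\simeq\mathcal{C}\circ P$. (2) $\mathcal{K}\circ CU\simeq CU\circ\mathcal{C}$.
   Context: $\mathsf{DL}$ is the category of bounded distributive lattices and bounded lattice homomorphisms. A Priestley space is a compact space with a partial order $\le$ such that if $x\nleq y$ then there is a clopen upset containing $x$ and missing $y$; $\mathsf{PS}$ is the category of Priestley spaces and continuous order-preserving maps. $P(L)$ is the set of (proper) prime filters of $L$ ordered by inclusion with the topology generated by the sets $a^+=\{x\mid a\in x\}$ and $a^-=\{x\mid a\notin x\}$, $a\in L$, and $P(f)=f^{-1}$. $CU(X)$ is the lattice of clopen upsets of $X$ and $CU(g)=g^{-1}$. These functors form a dual equivalence. For $L\in\mathsf{DL}$, $\mathcal{K}(L)=L^{\Diamond\Box}$ is the bounded distributive lattice freely generated by the set of symbols $\Diamond_a,\Box_a$ for $a\in L$ modulo the relations (for all $a,b\in L$): $\Diamond_0=0$, $\Diamond_a\vee\Diamond_b=\Diamond_{a\vee b}$, $\Box_1=1$, $\Box_a\wedge\Box_b=\Box_{a\wedge b}$, $\Box_{a\vee b}\le\Box_a\vee\Diamond_b$, and $\Box_a\wedge\Diamond_b\le\Diamond_{a\wedge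 b}$. For a homomorphism $f:L\to M$, $\mathcal{K}(f)$ is the homomorphism with $\mathcal{K}(f)(\Box_a)=\Box_{f(a)}$ and $\mathcal{K}(f)(\Diamond_a)=\Diamond_{f(a)}$. For $X\in\mathsf{PS}$, $\mathcal{C}(X)$ is the set of closed subsets $C$ of $X$ (including $\varnothing$) that are convex ($x,y\in C$ and $x\le z\le y$ imply $z\in C$), partially ordered by the Egli-Milner order ($A\sqsubseteq B$ iff $A\subseteq{\downarrow}B$ and $B\subseteq{\uparrow}A$), with the topology generated by the sets $\{C\mid C\cap S\neq\varnothing\}$ and $\{C\mid C\cap S=\varnothing\}$, where $S$ ranges over the clopen upsets and the clopen downsets of $X$; this is a Priestley space. For $f:X\to Y$ in $\mathsf{PS}$, $\mathcal{C}(f)(C)=f(C)^*$, where $A^*={\uparrow}A\cap{\downarrow}A$ is the convex hull of $A$. *)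

theory Defs
  imports "HOL-Analysis.Analysis" "HOL-Algebra.Lattice"
begin

section \<open>Concrete categories, contravariant functors and natural isomorphism\<close>

text \<open>
  Objects are structures whose underlying set is a subset of a type; morphisms are functions
  that are \<^const>\<open>extensional\<close> on the underlying set of the source, so that equality of morphisms
  is equality of functions.  Identities and composition are \<^term>\<open>restrict id\<close> and
  \<^const>\<open>compose\<close>.
\<close>

record ('o, 'a) concrete_category =
  obj :: "'o set"
  und :: "'o \<Rightarrow> 'a set"
  hom :: "'o \<Rightarrow> 'o \<Rightarrow> ('a \<Rightarrow> 'a) set"

definition contravariant_functor ::
  "('o, 'a) concrete_category \<Rightarrow> ('p, 'b) concrete_category \<Rightarrow>
   ('o \<Rightarrow> 'p) \<Rightarrow> ('o \<Rightarrow> 'o \<Rightarrow> ('a \<Rightarrow> 'a) \<Rightarrow> ('b \<Rightarrow> 'b)) \<Rightarrow> bool" where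
  "contravariant_functor A B Fo Fm \<longleftrightarrow>
     (\<forall>X\<in>obj A. Fo X \<in> obj B) \<and>
     (\<forall>X\<in>obj A. \<forall>Y\<in>obj A. \<forall>f\<in>hom A X Y. Fm X Y f \<in> hom B (Fo Y) (Fo X)) \<and>
     (\<forall>X\<in>obj A. Fm X X (restrict id (und A X)) = restrict id (und B (Fo X))) \<and>
     (\<forall>X\<in>obj A. \<forall>Y\<in>obj A. \<forall>Z\<in>obj A. \<forall>f\<in>hom A X Y. \<forall>g\<in>hom A Y Z.
        Fm X Z (compose (und A X) g f) = compose (und B (Fo Z)) (Fm X Y f) (Fm Y Z g))"

text \<open>
  The functors compared below land in the same category, but with underlying sets taken from
  different types.  So \<open>B\<close> and \<open>B'\<close> are two incarnations of one target category and
  \<open>isos Y Y'\<close> is its set of isomorphisms from an object of \<open>B\<close> to an object of \<open>B'\<close>.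
\<close>

definition contravariant_naturally_isomorphic ::
  "('o, 'a) concrete_category \<Rightarrow> ('p, 'b) concrete_category \<Rightarrow> ('q, 'c) concrete_category \<Rightarrow>
   ('p \<Rightarrow> 'q \<Rightarrow> ('b \<Rightarrow> 'c) set) \<Rightarrow>
   ('o \<Rightarrow> 'p) \<Rightarrow> ('o \<Rightarrow> 'o \<Rightarrow> ('a \<Rightarrow> 'a) \<Rightarrow> ('b \<Rightarrow> 'b)) \<Rightarrow>
   ('o \<Rightarrow> 'q) \<Rightarrow> ('o \<Rightarrow> 'o \<Rightarrow> ('a \<Rightarrow> 'a) \<Rightarrow> ('c \<Rightarrow> 'c)) \<Rightarrow> bool" where
  "contravariant_naturally_isomorphic A B B' isos Fo Fm Go Gm \<longleftrightarrow>
     contravariant_functor A B Fo Fm \<and> contravariant_functor A B' Go Gm \<and>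
     (\<exists>\<eta>. (\<forall>X\<in>obj A. \<eta> X \<in> isos (Fo X) (Go X)) \<and>
          (\<forall>X\<in>obj A. \<forall>Y\<in>obj A. \<forall>f\<in>hom A X Y.
             compose (und B (Fo Y)) (\<eta> X) (Fm X Y f) =
             compose (und B (Fo Y)) (Gm X Y f) (\<eta> Y)))"

section \<open>Bounded distributive lattices\<close>

locale bounded_distributive_lattice = bounded_lattice +
  assumes meet_join_distrib:
    "\<lbrakk>x \<in> carrier L; y \<in> carrier L; z \<in> carrier L\<rbrakk>
       \<Longrightarrow> x \<sqinter> (y \<squnion> z) = (x \<sqinter> y) \<squnion> (x \<sqinter> z)"

definition DL_hom :: "'a gorder \<Rightarrow> 'b gorder \<Rightarrow> ('a \<Rightarrow> 'b) set" where
  "DL_hom L M = {f \<in> carrier L \<rightarrow>\<^sub>E carrier M.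
     join_pres L M f \<and> meet_pres L M f \<and> f \<bottom>\<^bsub>L\<^esub> = \<bottom>\<^bsub>M\<^esub> \<and> f \<top>\<^bsub>L\<^esub> = \<top>\<^bsub>M\<^esub>}"

definition DL :: "('a gorder, 'a) concrete_category" where
  "DL = \<lparr>obj = {L. bounded_distributive_lattice L}, und = carrier, hom = DL_hom\<rparr>"

definition DL_iso :: "'a gorder \<Rightarrow> 'b gorder \<Rightarrow> ('a \<Rightarrow> 'b) set" where
  "DL_iso L M = {f \<in> DL_hom L M. \<exists>g\<in>DL_hom M L.
     compose (carrier L) g f = restrict id (carrier L) \<and>
     compose (carrier M) f g = restrict id (carrier M)}"

section \<open>Priestley spaces\<close>

record 'a ordered_space =
  topo :: "'a topology"
  ord :: "'a rel"

abbreviation points :: "'a ordered_space \<Rightarrow> 'a set" where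
  "points X \<equiv> topspace (topo X)"

definition up :: "'a ordered_space \<Rightarrow> 'a set \<Rightarrow> 'a set" where
  "up X A = ord X `` A"

definition down :: "'a ordered_space \<Rightarrow> 'a set \<Rightarrow> 'a set" where
  "down X A = (ord X)\<inverse> `` A"

definition clopen_upsets :: "'a ordered_space \<Rightarrow> 'a set set" where
  "clopen_upsets X = {U. openin (topo X) U \<and> closedin (topo X) U \<and> up X U \<subseteq> U}"

definition clopen_downsets :: "'a ordered_space \<Rightarrow> 'a set set" where
  "clopen_downsets X = {U. openin (topo X) U \<and> closedin (topo X) U \<and> down X U \<subseteq> U}"

definition priestley_space :: "'a ordered_space \<Rightarrow> bool" where
  "priestley_space X \<longleftrightarrow> compact_space (topo X) \<and> partial_order_on (points X) (ord X) \<and>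
     (\<forall>x\<in>points X. \<forall>y\<in>points X. (x, y) \<notin> ord X \<longrightarrow> (\<exists>U\<in>clopen_upsets X. x \<in> U \<and> y \<notin> U))"

definition PS_hom :: "'a ordered_space \<Rightarrow> 'b ordered_space \<Rightarrow> ('a \<Rightarrow> 'b) set" where
  "PS_hom X Y = {f \<in> extensional (points X). continuous_map (topo X) (topo Y) f \<and>
     (\<forall>x y. (x, y) \<in> ord X \<longrightarrow> (f x, f y) \<in> ord Y)}"

definition PS :: "('a ordered_space, 'a) concrete_category" where
  "PS = \<lparr>obj = {X. priestley_space X}, und = points, hom = PS_hom\<rparr>"

definition PS_iso :: "'a ordered_space \<Rightarrow> 'b ordered_space \<Rightarrow> ('a \<Rightarrow> 'b) set" where
  "PS_iso X Y = {f \<in> PS_hom X Y. \<exists>g\<in>PS_hom Y X.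
     compose (points X) g f = restrict id (points X) \<and>
     compose (points Y) f g = restrict id (points Y)}"

section \<open>The functors of Priestley duality\<close>

definition prime_filter :: "'a gorder \<Rightarrow> 'a set \<Rightarrow> bool" where
  "prime_filter L F \<longleftrightarrow> F \<subseteq> carrier L \<and> F \<noteq> carrier L \<and> \<top>\<^bsub>L\<^esub> \<in> F \<and>
     (\<forall>a\<in>F. \<forall>b\<in>carrier L. a \<sqsubseteq>\<^bsub>L\<^esub> b \<longrightarrow> b \<in> F) \<and>
     (\<forall>a\<in>F. \<forall>b\<in>F. a \<sqinter>\<^bsub>L\<^esub> b \<in> F) \<and>
     (\<forall>a\<in>carrier L. \<forall>b\<in>carrier L. a \<squnion>\<^bsub>L\<^esub> b \<in> F \<longrightarrow> a \<in> F \<or> b \<in> F)"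

definition P_obj :: "'a gorder \<Rightarrow> 'a set ordered_space" where
  "P_obj L = \<lparr>
     topo = topology_generated_by
       (\<Union>a\<in>carrier L. {{x. prime_filter L x \<and> a \<in> x}, {x. prime_filter L x \<and> a \<notin> x}}),
     ord = {(x, y). prime_filter L x \<and> prime_filter L y \<and> x \<subseteq> y}\<rparr>"

definition P_map :: "'a gorder \<Rightarrow> 'b gorder \<Rightarrow> ('a \<Rightarrow> 'b) \<Rightarrow> 'b set \<Rightarrow> 'a set" where
  "P_map L M f = (\<lambda>x\<in>{x. prime_filter M x}. {a \<in> carrier L. f a \<in> x})"

definition CU_obj :: "'a ordered_space \<Rightarrow> 'a set gorder" where
  "CU_obj X = \<lparr>carrier = clopen_upsets X, eq = (=), le = (\<subseteq>)\<rparr>"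

definition CU_map ::
  "'a ordered_space \<Rightarrow> 'b ordered_space \<Rightarrow> ('a \<Rightarrow> 'b) \<Rightarrow> 'b set \<Rightarrow> 'a set" where
  "CU_map X Y g = (\<lambda>U\<in>clopen_upsets Y. {x \<in> points X. g x \<in> U})"

section \<open>The functor adding modalities\<close>

datatype 'a modal_term =
    Dia 'a
  | Box 'a
  | TBot
  | TTop
  | TJoin "'a modal_term" "'a modal_term"
  | TMeet "'a modal_term" "'a modal_term"

definition modal_terms :: "'a gorder \<Rightarrow> 'a modal_term set" where
  "modal_terms L = {t. set_modal_term t \<subseteq> carrier L}"

text \<open>
  The least congruence on the term algebra that contains the identities of bounded distributive
  lattices and the defining relations; an inequality \<open>s \<le> t\<close> is read as \<open>s \<or> t = t\<close>.
\<close>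

inductive_set modal_cong :: "'a gorder \<Rightarrow> 'a modal_term rel" for L :: "'a gorder" where
  refl: "s \<in> modal_terms L \<Longrightarrow> (s, s) \<in> modal_cong L"
| sym: "(s, t) \<in> modal_cong L \<Longrightarrow> (t, s) \<in> modal_cong L"
| trans: "(s, t) \<in> modal_cong L \<Longrightarrow> (t, u) \<in> modal_cong L \<Longrightarrow> (s, u) \<in> modal_cong L"
| join_cong: "(s, s') \<in> modal_cong L \<Longrightarrow> (t, t') \<in> modal_cong L
    \<Longrightarrow> (TJoin s t, TJoin s' t') \<in> modal_cong L"
| meet_cong: "(s, s') \<in> modal_cong L \<Longrightarrow> (t, t') \<in> modal_cong L
    \<Longrightarrow> (TMeet s t, TMeet s' t') \<in> modal_cong L"
| join_assoc: "s \<in> modal_terms L \<Longrightarrow> t \<in> modal_terms L \<Longrightarrow> u \<in> modal_terms L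
    \<Longrightarrow> (TJoin (TJoin s t) u, TJoin s (TJoin t u)) \<in> modal_cong L"
| meet_assoc: "s \<in> modal_terms L \<Longrightarrow> t \<in> modal_terms L \<Longrightarrow> u \<in> modal_terms L
    \<Longrightarrow> (TMeet (TMeet s t) u, TMeet s (TMeet t u)) \<in> modal_cong L"
| join_comm: "s \<in> modal_terms L \<Longrightarrow> t \<in> modal_terms L
    \<Longrightarrow> (TJoin s t, TJoin t s) \<in> modal_cong L"
| meet_comm: "s \<in> modal_terms L \<Longrightarrow> t \<in> modal_terms L
    \<Longrightarrow> (TMeet s t, TMeet t s) \<in> modal_cong L"
| join_absorb: "s \<in> modal_terms L \<Longrightarrow> t \<in> modal_terms L
    \<Longrightarrow> (TJoin s (TMeet s t), s) \<in> modal_cong L"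
| meet_absorb: "s \<in> modal_terms L \<Longrightarrow> t \<in> modal_terms L
    \<Longrightarrow> (TMeet s (TJoin s t), s) \<in> modal_cong L"
| distrib: "s \<in> modal_terms L \<Longrightarrow> t \<in> modal_terms L \<Longrightarrow> u \<in> modal_terms L
    \<Longrightarrow> (TMeet s (TJoin t u), TJoin (TMeet s t) (TMeet s u)) \<in> modal_cong L"
| join_bot: "s \<in> modal_terms L \<Longrightarrow> (TJoin s TBot, s) \<in> modal_cong L"
| meet_top: "s \<in> modal_terms L \<Longrightarrow> (TMeet s TTop, s) \<in> modal_cong L"
| dia_bot: "(Dia \<bottom>\<^bsub>L\<^esub>, TBot) \<in> modal_cong L"
| dia_join: "a \<in> carrier L \<Longrightarrow> b \<in> carrier L
    \<Longrightarrow> (TJoin (Dia a) (Dia b), Dia (a \<squnion>\<^bsub>L\<^esub> b)) \<in> modal_cong L"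
| box_top: "(Box \<top>\<^bsub>L\<^esub>, TTop) \<in> modal_cong L"
| box_meet: "a \<in> carrier L \<Longrightarrow> b \<in> carrier L
    \<Longrightarrow> (TMeet (Box a) (Box b), Box (a \<sqinter>\<^bsub>L\<^esub> b)) \<in> modal_cong L"
| box_join_le: "a \<in> carrier L \<Longrightarrow> b \<in> carrier L
    \<Longrightarrow> (TJoin (Box (a \<squnion>\<^bsub>L\<^esub> b)) (TJoin (Box a) (Dia b)), TJoin (Box a) (Dia b)) \<in> modal_cong L"
| box_dia_le: "a \<in> carrier L \<Longrightarrow> b \<in> carrier L
    \<Longrightarrow> (TJoin (TMeet (Box a) (Dia b)) (Dia (a \<sqinter>\<^bsub>L\<^esub> b)), Dia (a \<sqinter>\<^bsub>L\<^esub> b)) \<in> modal_cong L"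

definition K_obj :: "'a gorder \<Rightarrow> 'a modal_term set gorder" where
  "K_obj L = \<lparr>
     carrier = modal_terms L // modal_cong L,
     eq = (=),
     le = (\<lambda>A B. \<exists>s\<in>A. \<exists>t\<in>B. (TJoin s t, t) \<in> modal_cong L)\<rparr>"

text \<open>On classes, the homomorphism induced by \<open>Dia a \<mapsto> Dia (f a)\<close> and \<open>Box a \<mapsto> Box (f a)\<close>.\<close>

definition K_map ::
  "'a gorder \<Rightarrow> 'b gorder \<Rightarrow> ('a \<Rightarrow> 'b) \<Rightarrow> 'a modal_term set \<Rightarrow> 'b modal_term set" where
  "K_map L M f = (\<lambda>A\<in>carrier (K_obj L). modal_cong M `` (map_modal_term f ` A))"

section \<open>The functor of closed convex subsets\<close>

definition convex_closed_sets :: "'a ordered_space \<Rightarrow> 'a set set" where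
  "convex_closed_sets X = {C. closedin (topo X) C \<and>
     (\<forall>x\<in>C. \<forall>y\<in>C. \<forall>z. (x, z) \<in> ord X \<and> (z, y) \<in> ord X \<longrightarrow> z \<in> C)}"

definition convex_closure :: "'a ordered_space \<Rightarrow> 'a set \<Rightarrow> 'a set" where
  "convex_closure X A = up X A \<inter> down X A"

definition C_obj :: "'a ordered_space \<Rightarrow> 'a set ordered_space" where
  "C_obj X = \<lparr>
     topo = topology_generated_by
       (\<Union>S\<in>clopen_upsets X \<union> clopen_downsets X.
          {{C \<in> convex_closed_sets X. C \<inter> S \<noteq> {}}, {C \<in> convex_closed_sets X. C \<inter> S = {}}}),
     ord = {(A, B). A \<in> convex_closed_sets X \<and> B \<in> convex_closed_sets X \<and>
              A \<subseteq> down X B \<and> B \<subseteq> up X A}\<rparr>"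

definition C_map ::
  "'a ordered_space \<Rightarrow> 'b ordered_space \<Rightarrow> ('a \<Rightarrow> 'b) \<Rightarrow> 'a set \<Rightarrow> 'b set" where
  "C_map X Y f = (\<lambda>A\<in>convex_closed_sets X. convex_closure Y (f ` A))"

end

(* A prime filter x of K(L) is the theory of a closed convex set of points, namely
   {p | Box a : x implies a : p, and a : p implies Dia a : x for all a}: if this set misses a clopen
   set, compactness reduces that to one inequality in L, and the two mixed relations between Box and
   Dia carry the inequality over to x.  Conversely the theory of a closed convex set determines it,
   because clopen upsets separate compact sets in a Priestley space.  Both claims are instances of
   this for a representation of L as the clopen upsets of a Priestley space X, namely
   X = P(L) in (1) and L = CU(X) in (2).  Compactness of C(X) follows as well, C(X) being a continuous
   image of the prime filter space of K(CU(X)).  In (2), surjectivity holds because a sublattice of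
   clopen upsets that separates the order contains every clopen upset. *)

theory Submission
  imports Defs
begin

section \<open>Prime filters of distributive lattices\<close>

text \<open>\<open>K_obj L\<close> is a quotient of terms for which no normal form is at hand, so
  equality and order of classes are not settled by calculation. They are settled by semantics:
  \<open>sat\<close> evaluates a term at a set of points. This is sound because each defining
  relation holds at every set of points, and complete because a failing inequality is witnessed by a
  prime filter of \<open>K_obj L\<close>, hence by the set of points belonging to it. Convexity is
  what lets a closed set be recovered: clopen upsets cannot tell a set from its convex hull, and
  antisymmetry of the Egli-Milner order rests on convexity. Compactness of \<open>C_obj X\<close>
  becomes available only after prime filters have been represented, so that representation must not
  rely on it.\<close>

text \<open>HOL-Algebra fixes joins, meets and bounds only through the order. Uniqueness of least
  and greatest elements identifies them with the concrete operations \<open>j\<close>,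
  \<open>m\<close> and constants \<open>b\<close>, \<open>t\<close>.\<close>

lemma bounded_distributive_latticeI:
  fixes L (structure)
  assumes eq: "(.=) = (=)"
    and refl: "\<And>x. x \<in> carrier L \<Longrightarrow> x \<sqsubseteq> x"
    and antisym: "\<And>x y. \<lbrakk>x \<sqsubseteq> y; y \<sqsubseteq> x; x \<in> carrier L; y \<in> carrier L\<rbrakk> \<Longrightarrow> x = y"
    and trans: "\<And>x y z. \<lbrakk>x \<sqsubseteq> y; y \<sqsubseteq> z; x \<in> carrier L; y \<in> carrier L; z \<in> carrier L\<rbrakk> \<Longrightarrow> x \<sqsubseteq> z"
    and j: "\<And>x y. \<lbrakk>x \<in> carrier L; y \<in> carrier L\<rbrakk> \<Longrightarrow> j x y \<in> carrier L \<and> x \<sqsubseteq> j x y \<and> y \<sqsubseteq> j x y"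
    and j_least: "\<And>x y z. \<lbrakk>x \<in> carrier L; y \<in> carrier L; z \<in> carrier L; x \<sqsubseteq> z; y \<sqsubseteq> z\<rbrakk> \<Longrightarrow> j x y \<sqsubseteq> z"
    and m: "\<And>x y. \<lbrakk>x \<in> carrier L; y \<in> carrier L\<rbrakk> \<Longrightarrow> m x y \<in> carrier L \<and> m x y \<sqsubseteq> x \<and> m x y \<sqsubseteq> y"
    and m_greatest: "\<And>x y z. \<lbrakk>x \<in> carrier L; y \<in> carrier L; z \<in> carrier L; z \<sqsubseteq> x; z \<sqsubseteq> y\<rbrakk> \<Longrightarrow> z \<sqsubseteq> m x y"
    and b: "b \<in> carrier L" "\<And>x. x \<in> carrier L \<Longrightarrow> b \<sqsubseteq> x"
    and t: "t \<in> carrier L" "\<And>x. x \<in> carrier L \<Longrightarrow> x \<sqsubseteq> t"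
    and dist: "\<And>x y z. \<lbrakk>x \<in> carrier L; y \<in> carrier L; z \<in> carrier L\<rbrakk> \<Longrightarrow> m x (j y z) = j (m x y) (m x z)"
  shows "bounded_distributive_lattice L"
    and "\<And>x y. \<lbrakk>x \<in> carrier L; y \<in> carrier L\<rbrakk> \<Longrightarrow> x \<squnion> y = j x y"
    and "\<And>x y. \<lbrakk>x \<in> carrier L; y \<in> carrier L\<rbrakk> \<Longrightarrow> x \<sqinter> y = m x y"
    and "\<bottom> = b" and "\<top> = t"
proof -
  have lub: "least L (j x y) (Upper L {x, y})" if "x \<in> carrier L" "y \<in> carrier L" for x y
    using that j by (intro least_UpperI) (auto intro!: j_least)
  have glb: "greatest L (m x y) (Lower L {x, y})" if "x \<in> carrier L" "y \<in> carrier L" for x y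
    using that m by (intro greatest_LowerI) (auto intro!: m_greatest)
  interpret bounded_lattice L
  proof
    show "\<exists>x. least L x (carrier L)" "\<exists>x. greatest L x (carrier L)"
      using b t by (auto simp: least_def greatest_def)
    show "\<exists>s. least L s (Upper L {x, y})" "\<exists>s. greatest L s (Lower L {x, y})"
      if "x \<in> carrier L" "y \<in> carrier L" for x y using lub glb that by blast+
  qed (use eq refl antisym trans in \<open>auto; fail\<close>)+
  show join: "x \<squnion> y = j x y" if "x \<in> carrier L" "y \<in> carrier L" for x y
    using joinI[of x y "\<lambda>z. z = j x y"] lub least_unique that by blast
  show meet: "x \<sqinter> y = m x y" if "x \<in> carrier L" "y \<in> carrier L" for x y
    using meetI[of x y "\<lambda>z. z = m x y"] glb greatest_unique that by blast
  show "bounded_distributive_lattice L"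
    by unfold_locales (simp add: join meet dist j m)
  show "\<bottom> = b" using b bottom_eq by metis
  show "\<top> = t" using t top_eq by metis
qed

text \<open>Unlike a prime filter, a filter in this sense may be improper. Properness is later a
  consequence of avoiding an ideal, which contains the bottom element.\<close>

definition lattice_filter :: "'a gorder \<Rightarrow> 'a set \<Rightarrow> bool" where
  "lattice_filter L F \<longleftrightarrow> F \<subseteq> carrier L \<and> \<top>\<^bsub>L\<^esub> \<in> F \<and>
     (\<forall>a\<in>F. \<forall>b\<in>carrier L. a \<sqsubseteq>\<^bsub>L\<^esub> b \<longrightarrow> b \<in> F) \<and> (\<forall>a\<in>F. \<forall>b\<in>F. a \<sqinter>\<^bsub>L\<^esub> b \<in> F)"

lemma lattice_filterD:
  fixes L (structure)
  assumes "lattice_filter L F"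
  shows "F \<subseteq> carrier L" and "\<top> \<in> F"
    and "\<And>a b. \<lbrakk>a \<in> F; b \<in> carrier L; a \<sqsubseteq> b\<rbrakk> \<Longrightarrow> b \<in> F"
    and "\<And>a b. \<lbrakk>a \<in> F; b \<in> F\<rbrakk> \<Longrightarrow> a \<sqinter> b \<in> F"
  using assms unfolding lattice_filter_def by simp_all

definition lattice_ideal :: "'a gorder \<Rightarrow> 'a set \<Rightarrow> bool" where
  "lattice_ideal L I \<longleftrightarrow> I \<subseteq> carrier L \<and> \<bottom>\<^bsub>L\<^esub> \<in> I \<and>
     (\<forall>a\<in>I. \<forall>b\<in>carrier L. b \<sqsubseteq>\<^bsub>L\<^esub> a \<longrightarrow> b \<in> I) \<and> (\<forall>a\<in>I. \<forall>b\<in>I. a \<squnion>\<^bsub>L\<^esub> b \<in> I)"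

locale DL_object = bounded_distributive_lattice L for L :: "'a gorder" (structure)
begin

(* As introduction rules these make the classical reasoner loop. *)
declare le_antisym [rule del] weak_refl [rule del] le_cong_l [rule del] le_cong_r [rule del]

lemma meet_mono:
  assumes "a \<sqsubseteq> c" "b \<sqsubseteq> d" "a \<in> carrier L" "b \<in> carrier L" "c \<in> carrier L" "d \<in> carrier L"
  shows "a \<sqinter> b \<sqsubseteq> c \<sqinter> d"
  using assms le_trans[OF meet_left] le_trans[OF meet_right] by (simp add: meet_le)

lemma join_mono:
  assumes "a \<sqsubseteq> c" "b \<sqsubseteq> d" "a \<in> carrier L" "b \<in> carrier L" "c \<in> carrier L" "d \<in> carrier L"
  shows "a \<squnion> b \<sqsubseteq> c \<squnion> d"
  using assms le_trans[OF _ join_left] le_trans[OF _ join_right] by (simp add: join_le)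

text \<open>Distributivity is what makes a maximal filter prime, and it enters here: the meet of
  \<open>m\<close>, \<open>n\<close> and \<open>a \<squnion> b\<close> splits into two parts, one
  below \<open>i\<close> and one below \<open>k\<close>. So if adjoining \<open>a\<close> and
  adjoining \<open>b\<close> both push the filter into the ideal, a filter containing their join
  meets the ideal already.\<close>

lemma filter_join_separation:
  assumes F: "lattice_filter L F" and I: "lattice_ideal L I"
    and a: "a \<in> carrier L" "m \<in> F" "i \<in> I" "m \<sqinter> a \<sqsubseteq> i"
    and b: "b \<in> carrier L" "n \<in> F" "k \<in> I" "n \<sqinter> b \<sqsubseteq> k"
    and ab: "a \<squnion> b \<in> F"
  shows "F \<inter> I \<noteq> {}"
proof -
  have c: "m \<in> carrier L" "n \<in> carrier L" "i \<in> carrier L" "k \<in> carrier L"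
    using F I a b by (auto simp: lattice_filter_def lattice_ideal_def)
  let ?x = "(m \<sqinter> n) \<sqinter> (a \<squnion> b)"
  have "?x = ((m \<sqinter> n) \<sqinter> a) \<squnion> ((m \<sqinter> n) \<sqinter> b)"
    using a b c by (simp add: meet_join_distrib)
  moreover have "(m \<sqinter> n) \<sqinter> a \<sqsubseteq> i"
    using le_trans[OF meet_mono[of "m \<sqinter> n" m a a] a(4)] a b c by (simp add: meet_left)
  moreover have "(m \<sqinter> n) \<sqinter> b \<sqsubseteq> k"
    using le_trans[OF meet_mono[of "m \<sqinter> n" n b b] b(4)] a b c by (simp add: meet_right)
  ultimately have "?x \<sqsubseteq> i \<squnion> k"
    using a b c by (simp add: join_mono)
  moreover have "?x \<in> F" "i \<squnion> k \<in> I"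
    using F I a b ab by (auto simp: lattice_filter_def lattice_ideal_def)
  ultimately have "i \<squnion> k \<in> F"
    using F c by (auto simp: lattice_filter_def)
  then show ?thesis using \<open>i \<squnion> k \<in> I\<close> by blast
qed

text \<open>The set is the filter generated by \<open>F\<close> and \<open>a\<close>. For closure
  under meets, the two witnesses from \<open>F\<close> are replaced by their meet.\<close>

lemma filter_extension:
  assumes F: "lattice_filter L F" and a: "a \<in> carrier L"
  shows "lattice_filter L {c \<in> carrier L. \<exists>m\<in>F. m \<sqinter> a \<sqsubseteq> c}" (is "lattice_filter L ?G")
    and "F \<subseteq> {c \<in> carrier L. \<exists>m\<in>F. m \<sqinter> a \<sqsubseteq> c}" and "a \<in> {c \<in> carrier L. \<exists>m\<in>F. m \<sqinter> a \<sqsubseteq> c}"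
proof -
  have Fc: "F \<subseteq> carrier L" "\<top> \<in> F" using F by (auto simp: lattice_filter_def)
  show "F \<subseteq> ?G" "a \<in> ?G" using Fc a meet_left meet_right by blast+
  have "c \<sqinter> d \<in> ?G" if c: "c \<in> ?G" and d: "d \<in> ?G" for c d
  proof -
    obtain m n where mn: "m \<in> F" "n \<in> F" "m \<sqinter> a \<sqsubseteq> c" "n \<sqinter> a \<sqsubseteq> d" using c d by blast
    then have mc: "m \<in> carrier L" "n \<in> carrier L" using Fc by auto
    have "(m \<sqinter> n) \<sqinter> a \<sqsubseteq> c"
      using le_trans[OF meet_mono[of "m \<sqinter> n" m a a] mn(3)] a mc c by (simp add: meet_left)
    moreover have "(m \<sqinter> n) \<sqinter> a \<sqsubseteq> d"
      using le_trans[OF meet_mono[of "m \<sqinter> n" n a a] mn(4)] a mc d by (simp add: meet_right)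
    ultimately have "(m \<sqinter> n) \<sqinter> a \<sqsubseteq> c \<sqinter> d"
      using c d mc a by (simp add: meet_le)
    moreover have "m \<sqinter> n \<in> F" using mn F by (auto simp: lattice_filter_def)
    ultimately show ?thesis using c d by auto
  qed
  moreover have "d \<in> ?G" if "c \<in> ?G" "d \<in> carrier L" "c \<sqsubseteq> d" for c d
    using that Fc a le_trans by (smt (verit, best) mem_Collect_eq meet_closed subsetD)
  moreover have "\<top> \<in> ?G" using Fc \<open>F \<subseteq> ?G\<close> by blast
  ultimately show "lattice_filter L ?G" unfolding lattice_filter_def by blast
qed

text \<open>Zorn's lemma gives a filter maximal among those that contain \<open>F\<close> and miss
  \<open>I\<close>. By maximality, adjoining any outside element makes it meet \<open>I\<close>, and
  \<open>filter_join_separation\<close> turns this into primeness.\<close>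

theorem prime_filter_extension:
  assumes F: "lattice_filter L F" and I: "lattice_ideal L I" and FI: "F \<inter> I = {}"
  obtains x where "prime_filter L x" "F \<subseteq> x" "x \<inter> I = {}"
proof -
  define A where "A = {G. lattice_filter L G \<and> F \<subseteq> G \<and> G \<inter> I = {}}"
  have "\<exists>M\<in>A. \<forall>X\<in>A. M \<subseteq> X \<longrightarrow> X = M"
  proof (rule subset_Zorn_nonempty)
    show "A \<noteq> {}" using F FI by (auto simp: A_def)
    fix \<C> assume ne: "\<C> \<noteq> {}" and ch: "subset.chain A \<C>"
    then have CA: "\<C> \<subseteq> A" by (auto simp: subset_chain_def)
    have fil: "\<And>G. G \<in> \<C> \<Longrightarrow> lattice_filter L G" using CA by (auto simp: A_def)
    have "a \<sqinter> b \<in> \<Union>\<C>" if ab: "a \<in> \<Union>\<C>" "b \<in> \<Union>\<C>" for a b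
    proof -
      obtain G H where GH: "G \<in> \<C>" "H \<in> \<C>" "a \<in> G" "b \<in> H" using ab by blast
      then have "G \<subseteq> H \<or> H \<subseteq> G" using ch by (auto simp: subset_chain_def)
      with GH have "\<exists>K\<in>\<C>. a \<in> K \<and> b \<in> K" by (metis subsetD)
      then obtain K where "K \<in> \<C>" "a \<in> K" "b \<in> K" by (elim bexE conjE)
      then show ?thesis using lattice_filterD(4)[OF fil] by (intro UnionI)
    qed
    moreover have "b \<in> \<Union>\<C>" if ab: "a \<in> \<Union>\<C>" "b \<in> carrier L" "a \<sqsubseteq> b" for a b
    proof -
      obtain G where "G \<in> \<C>" "a \<in> G" using ab(1) by blast
      then show ?thesis using lattice_filterD(3)[OF fil] ab by (intro UnionI)
    qed
    moreover have "\<Union>\<C> \<subseteq> carrier L" "\<top> \<in> \<Union>\<C>"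
      using lattice_filterD(1,2)[OF fil] ne by blast+
    ultimately have "lattice_filter L (\<Union>\<C>)"
      unfolding lattice_filter_def by (intro conjI ballI impI)
    then show "\<Union>\<C> \<in> A" using CA ne by (auto simp: A_def)
  qed
  then obtain M where M: "lattice_filter L M" "F \<subseteq> M" "M \<inter> I = {}"
    and "\<forall>X\<in>A. M \<subseteq> X \<longrightarrow> X = M" by (auto simp: A_def)
  then have max: "\<And>G. \<lbrakk>lattice_filter L G; M \<subseteq> G; G \<inter> I = {}\<rbrakk> \<Longrightarrow> G = M"
    by (simp add: A_def)
  have hit: "\<exists>m\<in>M. \<exists>i\<in>I. m \<sqinter> a \<sqsubseteq> i" if "a \<in> carrier L" "a \<notin> M" for a
  proof -
    have "{c \<in> carrier L. \<exists>m\<in>M. m \<sqinter> a \<sqsubseteq> c} \<inter> I \<noteq> {}"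
      using max[OF filter_extension(1,2)[OF M(1) that(1)]] filter_extension(3)[OF M(1) that(1)] that(2)
      by blast
    then show ?thesis by blast
  qed
  have "a \<in> M \<or> b \<in> M" if "a \<in> carrier L" "b \<in> carrier L" "a \<squnion> b \<in> M" for a b
    using hit[of a] hit[of b] filter_join_separation[OF M(1) I] that M(3) by metis
  moreover have "M \<noteq> carrier L" using I M(3) by (auto simp: lattice_ideal_def)
  ultimately have "prime_filter L M"
    using M(1) by (auto simp: prime_filter_def lattice_filter_def)
  then show thesis using that M by blast
qed

lemma principal_filter: "a \<in> carrier L \<Longrightarrow> lattice_filter L {c \<in> carrier L. a \<sqsubseteq> c}"
  unfolding lattice_filter_def by (auto intro: meet_le le_trans)

lemma principal_ideal: "a \<in> carrier L \<Longrightarrow> lattice_ideal L {c \<in> carrier L. c \<sqsubseteq> a}"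
  unfolding lattice_ideal_def by (auto intro: join_le le_trans)

corollary prime_filter_separates:
  assumes "a \<in> carrier L" "b \<in> carrier L" "\<not> a \<sqsubseteq> b"
  obtains x where "prime_filter L x" "a \<in> x" "b \<notin> x"
proof -
  have "{c \<in> carrier L. a \<sqsubseteq> c} \<inter> {c \<in> carrier L. c \<sqsubseteq> b} = {}"
    using assms le_trans by blast
  then obtain x where x: "prime_filter L x" "{c \<in> carrier L. a \<sqsubseteq> c} \<subseteq> x"
      "x \<inter> {c \<in> carrier L. c \<sqsubseteq> b} = {}"
    using prime_filter_extension[OF principal_filter principal_ideal] assms by blast
  then have "a \<in> x" "b \<notin> x" using assms by auto
  with x(1) show thesis by (rule that)
qed

lemma prime_filter_meet_iff:
  assumes "prime_filter L x" "a \<in> carrier L" "b \<in> carrier L"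
  shows "a \<sqinter> b \<in> x \<longleftrightarrow> a \<in> x \<and> b \<in> x"
  using assms meet_left[of a b] meet_right[of a b] unfolding prime_filter_def
  by (metis meet_closed)

lemma prime_filter_join_iff:
  assumes "prime_filter L x" "a \<in> carrier L" "b \<in> carrier L"
  shows "a \<squnion> b \<in> x \<longleftrightarrow> a \<in> x \<or> b \<in> x"
  using assms join_left[of a b] join_right[of a b] unfolding prime_filter_def
  by (metis join_closed)

lemma prime_filter_bottom: "prime_filter L x \<Longrightarrow> \<bottom> \<notin> x"
  unfolding prime_filter_def by (metis bottom_lower subset_antisym subsetI)

lemma prime_filter_top: "prime_filter L x \<Longrightarrow> \<top> \<in> x"
  unfolding prime_filter_def by blast

text \<open>The witness is the meet of \<open>B\<close>, with the top element for the empty set. It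
  is packaged by the properties that the compactness proof consumes, so that no operation of finite
  meet has to be developed.\<close>

lemma finite_lower_bound:
  assumes "finite B" "B \<subseteq> carrier L"
  obtains m where "m \<in> carrier L" "\<forall>b\<in>B. m \<sqsubseteq> b" "\<And>x. prime_filter L x \<Longrightarrow> B \<subseteq> x \<Longrightarrow> m \<in> x"
proof -
  have "\<exists>m\<in>carrier L. (\<forall>b\<in>B. m \<sqsubseteq> b) \<and> (\<forall>x. prime_filter L x \<longrightarrow> B \<subseteq> x \<longrightarrow> m \<in> x)"
    using assms
  proof (induction B)
    case empty
    then show ?case using prime_filter_top by blast
  next
    case (insert b B)
    then obtain m where m: "m \<in> carrier L" "\<forall>c\<in>B. m \<sqsubseteq> c"
      "\<forall>x. prime_filter L x \<longrightarrow> B \<subseteq> x \<longrightarrow> m \<in> x" by auto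
    have "c \<in> insert b B \<Longrightarrow> b \<sqinter> m \<sqsubseteq> c" for c
      using m insert.prems meet_left[of b m] meet_right[of b m] le_trans[of "b \<sqinter> m" m c] by auto
    then show ?case
      using m insert.prems by (intro bexI[of _ "b \<sqinter> m"]) (auto simp: prime_filter_meet_iff)
  qed
  then show thesis using that by blast
qed

lemma finite_upper_bound:
  assumes "finite A" "A \<subseteq> carrier L"
  obtains j where "j \<in> carrier L" "\<forall>a\<in>A. a \<sqsubseteq> j" "\<And>x. prime_filter L x \<Longrightarrow> j \<in> x \<Longrightarrow> x \<inter> A \<noteq> {}"
proof -
  have "\<exists>j\<in>carrier L. (\<forall>a\<in>A. a \<sqsubseteq> j) \<and> (\<forall>x. prime_filter L x \<longrightarrow> j \<in> x \<longrightarrow> x \<inter> A \<noteq> {})"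
    using assms
  proof (induction A)
    case empty
    then show ?case using prime_filter_bottom by blast
  next
    case (insert b A)
    then obtain j where j: "j \<in> carrier L" "\<forall>c\<in>A. c \<sqsubseteq> j"
      "\<forall>x. prime_filter L x \<longrightarrow> j \<in> x \<longrightarrow> x \<inter> A \<noteq> {}" by auto
    have "c \<in> insert b A \<Longrightarrow> c \<sqsubseteq> b \<squnion> j" for c
      using j insert.prems join_left[of b j] join_right[of b j] le_trans[of c j "b \<squnion> j"] by auto
    moreover have "prime_filter L x \<Longrightarrow> b \<squnion> j \<in> x \<Longrightarrow> x \<inter> insert b A \<noteq> {}" for x
      using j insert.prems by (auto simp: prime_filter_join_iff)
    ultimately show ?case
      using j insert.prems by (intro bexI[of _ "b \<squnion> j"]) auto
  qed
  then show thesis using that by blast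
qed

end

section \<open>The Priestley space of a lattice\<close>

lemma DL_homI:
  assumes "DL_object L" "DL_object M" "f \<in> carrier L \<rightarrow>\<^sub>E carrier M"
    and "\<And>a b. \<lbrakk>a \<in> carrier L; b \<in> carrier L\<rbrakk> \<Longrightarrow> f (a \<squnion>\<^bsub>L\<^esub> b) = f a \<squnion>\<^bsub>M\<^esub> f b"
    and "\<And>a b. \<lbrakk>a \<in> carrier L; b \<in> carrier L\<rbrakk> \<Longrightarrow> f (a \<sqinter>\<^bsub>L\<^esub> b) = f a \<sqinter>\<^bsub>M\<^esub> f b"
    and "f \<bottom>\<^bsub>L\<^esub> = \<bottom>\<^bsub>M\<^esub>" "f \<top>\<^bsub>L\<^esub> = \<top>\<^bsub>M\<^esub>"
  shows "f \<in> DL_hom L M"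
proof -
  interpret L: DL_object L by fact
  interpret M: DL_object M by fact
  show ?thesis
    using assms L.lattice_axioms M.lattice_axioms by (simp add: DL_hom_def join_pres_def meet_pres_def)
qed

lemma DL_homD:
  assumes "f \<in> DL_hom L M"
  shows "f \<in> carrier L \<rightarrow>\<^sub>E carrier M" and "\<And>a. a \<in> carrier L \<Longrightarrow> f a \<in> carrier M"
    and "\<And>a b. \<lbrakk>a \<in> carrier L; b \<in> carrier L\<rbrakk> \<Longrightarrow> f (a \<squnion>\<^bsub>L\<^esub> b) = f a \<squnion>\<^bsub>M\<^esub> f b"
    and "\<And>a b. \<lbrakk>a \<in> carrier L; b \<in> carrier L\<rbrakk> \<Longrightarrow> f (a \<sqinter>\<^bsub>L\<^esub> b) = f a \<sqinter>\<^bsub>M\<^esub> f b"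
    and "f \<bottom>\<^bsub>L\<^esub> = \<bottom>\<^bsub>M\<^esub>" "f \<top>\<^bsub>L\<^esub> = \<top>\<^bsub>M\<^esub>"
  using assms by (auto simp: DL_hom_def join_pres_def meet_pres_def)

lemma DL_hom_mono:
  assumes "DL_object L" "DL_object M" "f \<in> DL_hom L M"
    and "a \<in> carrier L" "b \<in> carrier L" "a \<sqsubseteq>\<^bsub>L\<^esub> b"
  shows "f a \<sqsubseteq>\<^bsub>M\<^esub> f b"
proof -
  interpret L: DL_object L by fact
  interpret M: DL_object M by fact
  have "f a \<squnion>\<^bsub>M\<^esub> f b = f b"
    using DL_homD(3)[OF assms(3-5)] L.le_iff_meet assms(4-6) by simp
  then show ?thesis using M.le_iff_meet DL_homD(2)[OF assms(3)] assms by simp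
qed

text \<open>The inverse preserves the operations because \<open>f\<close> sends both sides of each
  preservation law to the same element. It is restricted to the carrier since morphisms must be
  extensional.\<close>

lemma DL_iso_bij:
  assumes "DL_object L" "DL_object M" "f \<in> DL_hom L M" "bij_betw f (carrier L) (carrier M)"
  shows "f \<in> DL_iso L M"
proof -
  interpret L: DL_object L by fact
  interpret M: DL_object M by fact
  define g where "g = restrict (inv_into (carrier L) f) (carrier M)"
  have fg: "f (g b) = b" "g b \<in> carrier L" if "b \<in> carrier M" for b
    using assms(4) that by (auto simp: g_def bij_betw_inv_into_right bij_betw_def inv_into_into)
  have gf: "g (f a) = a" if "a \<in> carrier L" for a
    using assms(3,4) that DL_homD(2)[OF assms(3) that] by (simp add: g_def bij_betw_inv_into_left)
  note hom = DL_homD[OF assms(3)]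
  have "g \<in> DL_hom M L"
  proof (rule DL_homI[OF assms(2,1)])
    show "g \<in> carrier M \<rightarrow>\<^sub>E carrier L" using fg by (auto simp: g_def)
    fix a b assume ab: "a \<in> carrier M" "b \<in> carrier M"
    have "f (g a \<squnion>\<^bsub>L\<^esub> g b) = a \<squnion>\<^bsub>M\<^esub> b" "f (g a \<sqinter>\<^bsub>L\<^esub> g b) = a \<sqinter>\<^bsub>M\<^esub> b"
      using hom fg ab by simp_all
    then show "g (a \<squnion>\<^bsub>M\<^esub> b) = g a \<squnion>\<^bsub>L\<^esub> g b" "g (a \<sqinter>\<^bsub>M\<^esub> b) = g a \<sqinter>\<^bsub>L\<^esub> g b"
      using gf[of "g a \<squnion>\<^bsub>L\<^esub> g b"] gf[of "g a \<sqinter>\<^bsub>L\<^esub> g b"] fg ab by simp_all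
  next
    show "g \<bottom>\<^bsub>M\<^esub> = \<bottom>\<^bsub>L\<^esub>" "g \<top>\<^bsub>M\<^esub> = \<top>\<^bsub>L\<^esub>"
      using gf[of "\<bottom>\<^bsub>L\<^esub>"] gf[of "\<top>\<^bsub>L\<^esub>"] hom by simp_all
  qed
  moreover have "compose (carrier L) g f = restrict id (carrier L)"
    "compose (carrier M) f g = restrict id (carrier M)"
    using fg gf by (auto simp: compose_def restrict_def fun_eq_iff)
  ultimately show ?thesis using assms(3) by (auto simp: DL_iso_def)
qed

section \<open>Compactness and order separation of the prime filter space\<close>

text \<open>This is Alexander's subbase theorem. The work lies in matching two descriptions of the
  generated topology: unions of finite intersections relative to \<open>\<Union>B\<close>, and the
  inductive closure \<open>generate_topology_on\<close>.\<close>

lemma compact_space_topology_generated_by: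
  assumes fin: "\<And>C. \<lbrakk>C \<subseteq> B; \<Union>C = \<Union>B\<rbrakk> \<Longrightarrow> \<exists>C'. finite C' \<and> C' \<subseteq> C \<and> \<Union>C' = \<Union>B"
  shows "compact_space (topology_generated_by B)"
proof (rule Alexander_subbase)
  let ?T = "arbitrary union_of (finite intersection_of (\<lambda>x. x \<in> B) relative_to \<Union>B)"
  have "?T S = generate_topology_on B S" for S
  proof
    assume "generate_topology_on B S"
    moreover have "?T U" if "U \<in> B" for U
    proof -
      have "(finite intersection_of (\<lambda>x. x \<in> B) relative_to \<Union>B) (\<Union>B \<inter> U)"
        using that by (intro relative_to_inc finite_intersection_of_inc)
      moreover have "\<Union>B \<inter> U = U" using that by blast
      ultimately show ?thesis by (simp add: arbitrary_union_of_inc)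
    qed
    ultimately show "?T S"
      using generate_topology_on_coarsest[OF istopology_subbase] by blast
  next
    have top: "generate_topology_on B (\<Union>B)" by (auto intro: generate_topology_on.intros)
    have "generate_topology_on B (\<Union>B \<inter> \<Inter>\<F>)" if "finite \<F>" "\<F> \<subseteq> B" for \<F>
      using that
    proof (induction \<F>)
      case (insert V \<F>)
      then have "generate_topology_on B (V \<inter> (\<Union>B \<inter> \<Inter>\<F>))"
        by (auto intro: generate_topology_on.intros)
      then show ?case by (simp add: Int_left_commute)
    qed (use top in simp)
    then have "generate_topology_on B V"
      if "(finite intersection_of (\<lambda>x. x \<in> B) relative_to \<Union>B) V" for V
      using that by (auto simp: relative_to_def intersection_of_def)
    moreover assume "?T S"
    ultimately show "generate_topology_on B S"
      by (auto simp: union_of_def intro!: generate_topology_on.UN)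
  qed
  then show "topology ?T = topology_generated_by B" by presburger
qed (use fin in auto)

definition prime_set :: "'a gorder \<Rightarrow> 'a \<Rightarrow> 'a set set" where
  "prime_set L a = {x. prime_filter L x \<and> a \<in> x}"

context DL_object
begin

lemma points_P: "points (P_obj L) = {x. prime_filter L x}"
  using top_closed by (auto simp: P_obj_def)

lemma prime_set_Compl: "points (P_obj L) - prime_set L a = {x. prime_filter L x \<and> a \<notin> x}"
  by (auto simp: points_P prime_set_def)

lemma prime_set_clopen:
  assumes "a \<in> carrier L"
  shows "openin (topo (P_obj L)) (prime_set L a)" "closedin (topo (P_obj L)) (prime_set L a)"
proof -
  show "openin (topo (P_obj L)) (prime_set L a)"
    unfolding P_obj_def prime_set_def ordered_space.simps
    using assms by (intro topology_generated_by_Basis) blast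
  have "openin (topo (P_obj L)) (points (P_obj L) - prime_set L a)"
    unfolding prime_set_Compl unfolding P_obj_def ordered_space.simps
    using assms by (intro topology_generated_by_Basis) blast
  moreover have "prime_set L a \<subseteq> points (P_obj L)" by (auto simp: points_P prime_set_def)
  ultimately show "closedin (topo (P_obj L)) (prime_set L a)" by (simp add: closedin_def)
qed

lemma prime_set_upset: "a \<in> carrier L \<Longrightarrow> prime_set L a \<in> clopen_upsets (P_obj L)"
  using prime_set_clopen by (auto simp: clopen_upsets_def up_def P_obj_def prime_set_def)

text \<open>By Alexander's theorem only covers by subbasic sets matter. The prime filter theorem
  shows that the filter generated by the elements of the negative cover members meets the ideal
  generated by those of the positive ones; a common element involves finitely many of each, and
  these already cover.\<close>

lemma compact_P: "compact_space (topo (P_obj L))"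
  unfolding P_obj_def ordered_space.simps
proof (rule compact_space_topology_generated_by)
  let ?n = "\<lambda>a. {x. prime_filter L x \<and> a \<notin> x}"
  let ?B = "\<Union>a\<in>carrier L. {{x. prime_filter L x \<and> a \<in> x}, ?n a}"
  have UB: "\<Union>?B = {x. prime_filter L x}" using top_closed by auto
  fix C assume CB: "C \<subseteq> ?B" and CU: "\<Union>C = \<Union>?B"
  define A where "A = {a \<in> carrier L. prime_set L a \<in> C}"
  define N where "N = {a \<in> carrier L. ?n a \<in> C}"
  \<comment> \<open>\<open>F\<close> is the filter generated by \<open>N\<close>, and
    \<open>I\<close> below is the ideal generated by \<open>A\<close>. Membership is phrased through
    common bounds of a finite subset, which avoids finite meets and joins.\<close>
  define F where "F = {c \<in> carrier L. \<exists>S. finite S \<and> S \<subseteq> N \<and> (\<forall>d\<in>carrier L. (\<forall>b\<in>S. d \<sqsubseteq> b) \<longrightarrow> d \<sqsubseteq> c)}"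
  define I where "I = {c \<in> carrier L. \<exists>S. finite S \<and> S \<subseteq> A \<and> (\<forall>d\<in>carrier L. (\<forall>b\<in>S. b \<sqsubseteq> d) \<longrightarrow> c \<sqsubseteq> d)}"
  have F: "lattice_filter L F"
    unfolding lattice_filter_def
  proof (intro conjI ballI impI)
    show "F \<subseteq> carrier L" by (auto simp: F_def)
    show "\<top> \<in> F" unfolding F_def by (auto intro!: exI[of _ "{}"])
    fix a assume a: "a \<in> F"
    then obtain S where S: "finite S" "S \<subseteq> N" "\<And>d. d\<in>carrier L \<Longrightarrow> (\<forall>b\<in>S. d \<sqsubseteq> b) \<Longrightarrow> d \<sqsubseteq> a"
      and ac: "a \<in> carrier L"
      by (auto simp: F_def)
    { fix b assume b: "b \<in> carrier L" "a \<sqsubseteq> b"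
      have "d \<sqsubseteq> b" if "d \<in> carrier L" "\<forall>b\<in>S. d \<sqsubseteq> b" for d
        by (rule le_trans[OF S(3)[OF that] b(2) that(1) ac b(1)])
      then show "b \<in> F" unfolding F_def using S(1,2) b(1) by blast }
    fix b assume b: "b \<in> F"
    then obtain T where T: "finite T" "T \<subseteq> N" "\<And>d. d\<in>carrier L \<Longrightarrow> (\<forall>b\<in>T. d \<sqsubseteq> b) \<Longrightarrow> d \<sqsubseteq> b"
      and bc: "b \<in> carrier L"
      by (auto simp: F_def)
    have "d \<sqsubseteq> a \<sqinter> b" if "d \<in> carrier L" "\<forall>b\<in>S \<union> T. d \<sqsubseteq> b" for d
      using that S(3) T(3) ac bc by (intro meet_le) auto
    then show "a \<sqinter> b \<in> F" unfolding F_def using S(1,2) T(1,2) ac bc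
      by (intro CollectI conjI exI[of _ "S \<union> T"]) auto
  qed
  have I: "lattice_ideal L I"
    unfolding lattice_ideal_def
  proof (intro conjI ballI impI)
    show "I \<subseteq> carrier L" by (auto simp: I_def)
    show "\<bottom> \<in> I" unfolding I_def by (auto intro!: exI[of _ "{}"])
    fix a assume a: "a \<in> I"
    then obtain S where S: "finite S" "S \<subseteq> A" "\<And>d. d\<in>carrier L \<Longrightarrow> (\<forall>b\<in>S. b \<sqsubseteq> d) \<Longrightarrow> a \<sqsubseteq> d"
      and ac: "a \<in> carrier L"
      by (auto simp: I_def)
    { fix b assume b: "b \<in> carrier L" "b \<sqsubseteq> a"
      have "b \<sqsubseteq> d" if "d \<in> carrier L" "\<forall>b\<in>S. b \<sqsubseteq> d" for d
        by (rule le_trans[OF b(2) S(3)[OF that] b(1) ac that(1)])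
      then show "b \<in> I" unfolding I_def using S(1,2) b(1) by blast }
    fix b assume b: "b \<in> I"
    then obtain T where T: "finite T" "T \<subseteq> A" "\<And>d. d\<in>carrier L \<Longrightarrow> (\<forall>b\<in>T. b \<sqsubseteq> d) \<Longrightarrow> b \<sqsubseteq> d"
      and bc: "b \<in> carrier L"
      by (auto simp: I_def)
    have "a \<squnion> b \<sqsubseteq> d" if "d \<in> carrier L" "\<forall>b\<in>S \<union> T. b \<sqsubseteq> d" for d
      using that S(3) T(3) ac bc by (intro join_le) auto
    then show "a \<squnion> b \<in> I" unfolding I_def using S(1,2) T(1,2) ac bc
      by (intro CollectI conjI exI[of _ "S \<union> T"]) auto
  qed
  \<comment> \<open>Otherwise some prime filter contains \<open>F\<close> and misses
    \<open>I\<close>, and such a point lies in no member of the cover.\<close>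
  have "F \<inter> I \<noteq> {}"
  proof
    assume "F \<inter> I = {}"
    then obtain x where x: "prime_filter L x" "F \<subseteq> x" "x \<inter> I = {}"
      using prime_filter_extension[OF F I] by blast
    from x(1) have "x \<in> \<Union>C" unfolding CU UB by simp
    then obtain U where U: "U \<in> C" "x \<in> U" by (rule UnionE)
    then obtain a where a: "a \<in> carrier L" "U = prime_set L a \<or> U = ?n a"
      using CB unfolding prime_set_def by blast
    from a(2) show False
    proof
      assume "U = prime_set L a"
      then have "a \<in> A" "a \<in> x" using U a(1) unfolding A_def prime_set_def by simp_all
      moreover have "a \<in> I" unfolding I_def using a(1) \<open>a \<in> A\<close>
        by (intro CollectI conjI exI[of _ "{a}"]) auto
      ultimately show False using x(3) by blast
    next
      assume "U = ?n a"
      then have "a \<in> N" "a \<notin> x" using U a by (auto simp: N_def)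
      moreover have "a \<in> F" unfolding F_def using a(1) \<open>a \<in> N\<close>
        by (intro CollectI conjI exI[of _ "{a}"]) auto
      ultimately show False using x(2) by blast
    qed
  qed
  then obtain c where "c \<in> F" "c \<in> I" by blast
  then obtain S T where c: "c \<in> carrier L"
    and S: "finite S" "S \<subseteq> N" "\<And>d. d\<in>carrier L \<Longrightarrow> (\<forall>b\<in>S. d \<sqsubseteq> b) \<Longrightarrow> d \<sqsubseteq> c"
    and T: "finite T" "T \<subseteq> A" "\<And>d. d\<in>carrier L \<Longrightarrow> (\<forall>b\<in>T. b \<sqsubseteq> d) \<Longrightarrow> c \<sqsubseteq> d"
    by (auto simp: F_def I_def)
  have "S \<subseteq> carrier L" "T \<subseteq> carrier L" using S T by (auto simp: N_def A_def)
  with S(1) T(1) obtain m j where m: "m \<in> carrier L" "\<forall>b\<in>S. m \<sqsubseteq> b"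
      "\<And>x. prime_filter L x \<Longrightarrow> S \<subseteq> x \<Longrightarrow> m \<in> x"
    and j: "j \<in> carrier L" "\<forall>a\<in>T. a \<sqsubseteq> j" "\<And>x. prime_filter L x \<Longrightarrow> j \<in> x \<Longrightarrow> x \<inter> T \<noteq> {}"
    using finite_lower_bound finite_upper_bound by metis
  \<comment> \<open>The meet of \<open>S\<close> lies below the join of \<open>T\<close>, so a prime
    filter that contains \<open>S\<close> contains some element of \<open>T\<close>; a prime filter
    that does not contain \<open>S\<close> lies in one of the negative sets.\<close>
  have mj: "m \<sqsubseteq> j" by (rule le_trans[OF S(3)[OF m(1,2)] T(3)[OF j(1,2)] m(1) c j(1)])
  let ?C = "prime_set L ` T \<union> ?n ` S"
  have "?C \<subseteq> C" using S T by (auto simp: N_def A_def)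
  moreover have cov: "x \<in> \<Union>?C" if x: "prime_filter L x" for x
  proof (cases "S \<subseteq> x")
    case True
    then have "j \<in> x" using m(3)[OF x] x mj j(1) unfolding prime_filter_def by blast
    then show ?thesis using j(3)[OF x] x by (auto simp: prime_set_def)
  next
    case False
    then show ?thesis using x by auto
  qed
  moreover have "\<Union>?C \<subseteq> {x. prime_filter L x}" by (auto simp: prime_set_def)
  then have "\<Union>?C = \<Union>?B" unfolding UB using cov by (simp add: set_eq_subset subset_iff)
  ultimately show "\<exists>C'. finite C' \<and> C' \<subseteq> C \<and> \<Union>C' = \<Union>?B"
    using S(1) T(1) by (intro exI[of _ ?C]) simp
qed

lemma priestley_P: "priestley_space (P_obj L)"
  unfolding priestley_space_def
proof (intro conjI ballI impI)
  show "compact_space (topo (P_obj L))" by (rule compact_P)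
  show "partial_order_on (points (P_obj L)) (ord (P_obj L))"
    unfolding points_P by (auto simp: P_obj_def order_on_defs refl_on_def trans_def antisym_def)
next
  fix x y assume "x \<in> points (P_obj L)" "y \<in> points (P_obj L)" "(x, y) \<notin> ord (P_obj L)"
  then have xy: "prime_filter L x" "prime_filter L y" "\<not> x \<subseteq> y"
    by (auto simp: points_P) (auto simp: P_obj_def)
  then obtain a where "a \<in> x" "a \<notin> y" "a \<in> carrier L" unfolding prime_filter_def by blast
  then show "\<exists>U\<in>clopen_upsets (P_obj L). x \<in> U \<and> y \<notin> U"
    using prime_set_upset[of a] xy by (intro bexI[of _ "prime_set L a"]) (auto simp: prime_set_def)
qed

end

section \<open>Functoriality of the prime filter space\<close>

lemma prime_filter_subset: "prime_filter L x \<Longrightarrow> x \<subseteq> carrier L"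
  by (simp add: prime_filter_def)

lemma prime_filter_up:
  fixes L (structure)
  shows "\<lbrakk>prime_filter L x; a \<in> x; b \<in> carrier L; a \<sqsubseteq> b\<rbrakk> \<Longrightarrow> b \<in> x"
  unfolding prime_filter_def by simp

lemma P_map_prime:
  assumes "DL_object L" "DL_object M" and f: "f \<in> DL_hom L M" and x: "prime_filter M x"
  shows "prime_filter L {a \<in> carrier L. f a \<in> x}"
proof -
  interpret L: DL_object L by fact
  interpret M: DL_object M by fact
  note hom = DL_homD[OF f]
  show ?thesis
    unfolding prime_filter_def
  proof (intro conjI ballI impI)
    have "\<bottom>\<^bsub>L\<^esub> \<notin> {a \<in> carrier L. f a \<in> x}"
      using M.prime_filter_bottom[OF x] hom(5) by simp
    then show "{a \<in> carrier L. f a \<in> x} \<noteq> carrier L" using L.bottom_closed by metis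
    show "\<top>\<^bsub>L\<^esub> \<in> {a \<in> carrier L. f a \<in> x}"
      using M.prime_filter_top[OF x] hom(6) L.top_closed by auto
  next
    fix a b assume ab: "a \<in> {a \<in> carrier L. f a \<in> x}" "b \<in> carrier L" "a \<sqsubseteq>\<^bsub>L\<^esub> b"
    then show "b \<in> {a \<in> carrier L. f a \<in> x}"
      using prime_filter_up[OF x, of "f a" "f b"] DL_hom_mono[OF assms(1-3)] hom(2) by simp
  next
    fix a b assume "a \<in> {a \<in> carrier L. f a \<in> x}" "b \<in> {a \<in> carrier L. f a \<in> x}"
    then show "a \<sqinter>\<^bsub>L\<^esub> b \<in> {a \<in> carrier L. f a \<in> x}"
      using hom M.prime_filter_meet_iff[OF x] by simp
  next
    fix a b assume "a \<in> carrier L" "b \<in> carrier L" "a \<squnion>\<^bsub>L\<^esub> b \<in> {a \<in> carrier L. f a \<in> x}"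
    then show "a \<in> {a \<in> carrier L. f a \<in> x} \<or> b \<in> {a \<in> carrier L. f a \<in> x}"
      using hom M.prime_filter_join_iff[OF x] by simp
  qed auto
qed

lemma P_map_hom:
  assumes "DL_object L" "DL_object M" and f: "f \<in> DL_hom L M"
  shows "P_map L M f \<in> PS_hom (P_obj M) (P_obj L)"
proof -
  interpret L: DL_object L by fact
  interpret M: DL_object M by fact
  have val: "P_map L M f x = {a \<in> carrier L. f a \<in> x}" if "prime_filter M x" for x
    using that by (simp add: P_map_def)
  have "continuous_map (topo (P_obj M)) (topo (P_obj L)) (P_map L M f)"
    unfolding P_obj_def[of L] ordered_space.simps
  proof (rule continuous_on_generated_topo)
    show "P_map L M f ` points (P_obj M)
        \<subseteq> \<Union> (\<Union>a\<in>carrier L. {{x. prime_filter L x \<and> a \<in> x}, {x. prime_filter L x \<and> a \<notin> x}})"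
      using L.top_closed P_map_prime[OF assms] by (auto simp: M.points_P val)
    fix U assume "U \<in> (\<Union>a\<in>carrier L. {{x. prime_filter L x \<and> a \<in> x}, {x. prime_filter L x \<and> a \<notin> x}})"
    then obtain a where a: "a \<in> carrier L" "U = prime_set L a \<or> U = points (P_obj L) - prime_set L a"
      by (auto simp flip: prime_set_def L.prime_set_Compl)
    have "P_map L M f -` prime_set L a \<inter> points (P_obj M) = prime_set M (f a)"
      "P_map L M f -` (points (P_obj L) - prime_set L a) \<inter> points (P_obj M)
         = points (P_obj M) - prime_set M (f a)"
      using a(1) P_map_prime[OF assms] by (auto simp: M.points_P L.points_P prime_set_def val)
    then show "openin (topo (P_obj M)) (P_map L M f -` U \<inter> points (P_obj M))"
      using a M.prime_set_clopen[of "f a"] DL_homD(2)[OF f] by (auto simp: closedin_def)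
  qed
  moreover have "(P_map L M f x, P_map L M f y) \<in> ord (P_obj L)" if "(x, y) \<in> ord (P_obj M)" for x y
    using that P_map_prime[OF assms] unfolding P_obj_def by (force simp: val)
  ultimately show ?thesis
    by (auto simp: PS_hom_def M.points_P) (simp add: P_map_def)
qed

lemma P_map_id:
  assumes "DL_object L"
  shows "P_map L L (restrict id (carrier L)) = restrict id (points (P_obj L))"
proof -
  interpret L: DL_object L by fact
  have "{a \<in> carrier L. restrict id (carrier L) a \<in> x} = x" if "prime_filter L x" for x
    using prime_filter_subset[OF that] by auto
  then show ?thesis by (simp add: fun_eq_iff P_map_def L.points_P)
qed

lemma P_map_compose:
  assumes "DL_object L" "DL_object M" "DL_object N" "f \<in> DL_hom L M" "g \<in> DL_hom M N"
  shows "P_map L N (compose (carrier L) g f) = compose (points (P_obj N)) (P_map L M f) (P_map M N g)"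
proof -
  interpret N: DL_object N by fact
  show ?thesis
    using P_map_prime[OF assms(2,3,5)] DL_homD(2)[OF assms(4)]
    by (auto simp: fun_eq_iff P_map_def compose_def restrict_def N.points_P)
qed

section \<open>Clopen upsets of Priestley spaces\<close>

text \<open>Compactness is used twice: for a fixed \<open>b\<close>, finitely many sets missing
  \<open>b\<close> cover \<open>A\<close>; then finitely many complements cover \<open>B\<close>.
  The family is an arbitrary lattice of clopen sets, so that the same argument serves
  \<open>upset_separation\<close> and \<open>separating_sublattice\<close>.\<close>

lemma compact_separation:
  assumes A: "compactin T A" and B: "compactin T B"
    and clopen: "\<And>U. U \<in> \<U> \<Longrightarrow> openin T U \<and> closedin T U"
    and empty: "{} \<in> \<U>" and top: "topspace T \<in> \<U>"
    and Un: "\<And>U V. \<lbrakk>U \<in> \<U>; V \<in> \<U>\<rbrakk> \<Longrightarrow> U \<union> V \<in> \<U>" and Int: "\<And>U V. \<lbrakk>U \<in> \<U>; V \<in> \<U>\<rbrakk> \<Longrightarrow> U \<inter> V \<in> \<U>"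
    and sep: "\<And>a b. \<lbrakk>a \<in> A; b \<in> B\<rbrakk> \<Longrightarrow> \<exists>U\<in>\<U>. a \<in> U \<and> b \<notin> U"
  shows "\<exists>U\<in>\<U>. A \<subseteq> U \<and> U \<inter> B = {}"
proof -
  have AT: "A \<subseteq> topspace T" and BT: "B \<subseteq> topspace T"
    using A B by (auto simp: compactin_def)
  have union: "\<Union>\<F> \<in> \<U>" if "finite \<F>" "\<F> \<subseteq> \<U>" for \<F>
    using that by (induction \<F>) (auto simp: empty Un)
  have point: "\<exists>U\<in>\<U>. A \<subseteq> U \<and> b \<notin> U" if b: "b \<in> B" for b
  proof -
    have "\<forall>U\<in>{U \<in> \<U>. b \<notin> U}. openin T U" "A \<subseteq> \<Union>{U \<in> \<U>. b \<notin> U}"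
      using clopen sep[OF _ b] by auto
    then obtain \<F> where "finite \<F>" "\<F> \<subseteq> {U \<in> \<U>. b \<notin> U}" "A \<subseteq> \<Union>\<F>"
      using A unfolding compactin_def by meson
    then show ?thesis using union[of \<F>] by blast
  qed
  \<comment> \<open>The complements of the sets obtained in \<open>point\<close>; these are open and
    cover \<open>B\<close>.\<close>
  let ?\<V> = "(-) (topspace T) ` {U \<in> \<U>. A \<subseteq> U}"
  have "\<forall>V\<in>?\<V>. openin T V" using clopen by auto
  moreover have "B \<subseteq> \<Union>?\<V>" using point BT by fastforce
  ultimately obtain \<F> where F: "finite \<F>" "\<F> \<subseteq> ?\<V>" "B \<subseteq> \<Union>\<F>"
    using B unfolding compactin_def by meson
  have "\<exists>U\<in>\<U>. A \<subseteq> U \<and> (\<forall>V\<in>\<F>. U \<inter> V = {})"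
    using F(1,2)
  proof (induction \<F>)
    case empty
    then show ?case using top AT by blast
  next
    case (insert V \<F>)
    then obtain U W where UW: "U \<in> \<U>" "A \<subseteq> U" "\<forall>V\<in>\<F>. U \<inter> V = {}"
      "V = topspace T - W" "W \<in> \<U>" "A \<subseteq> W" by auto
    have "(U \<inter> W) \<inter> V' = {}" if "V' \<in> insert V \<F>" for V'
      using that UW by auto
    then show ?case using UW Int[of U W] by (intro bexI[of _ "U \<inter> W"]) auto
  qed
  then obtain U where U: "U \<in> \<U>" "A \<subseteq> U" "\<forall>V\<in>\<F>. U \<inter> V = {}" by blast
  moreover have "U \<inter> B = {}" using U(3) F(3) by blast
  ultimately show ?thesis by blast
qed

locale priestley =
  fixes X :: "'a ordered_space"
  assumes priestley: "priestley_space X"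
begin

lemma compact: "compact_space (topo X)"
  using priestley by (simp add: priestley_space_def)

lemma ord_points: "(x, y) \<in> ord X \<Longrightarrow> x \<in> points X \<and> y \<in> points X"
  and ord_refl: "x \<in> points X \<Longrightarrow> (x, x) \<in> ord X"
  and ord_trans: "(x, y) \<in> ord X \<Longrightarrow> (y, z) \<in> ord X \<Longrightarrow> (x, z) \<in> ord X"
  using priestley unfolding priestley_space_def order_on_defs refl_on_def
  by (blast dest: transD)+

lemma ord_separates:
  assumes "x \<in> points X" "y \<in> points X" "(x, y) \<notin> ord X"
  shows "\<exists>U\<in>clopen_upsets X. x \<in> U \<and> y \<notin> U"
  using assms priestley by (simp add: priestley_space_def)

lemma clopen_upsetD:
  assumes "U \<in> clopen_upsets X"
  shows "openin (topo X) U" "closedin (topo X) U" "U \<subseteq> points X"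
    and "\<And>x y. \<lbrakk>x \<in> U; (x, y) \<in> ord X\<rbrakk> \<Longrightarrow> y \<in> U"
  using assms by (auto simp: clopen_upsets_def up_def dest: closedin_subset)

lemma clopen_upsets_empty: "{} \<in> clopen_upsets X"
  by (simp add: clopen_upsets_def up_def)

lemma clopen_upsets_points: "points X \<in> clopen_upsets X"
  using ord_points by (auto simp: clopen_upsets_def up_def)

lemma clopen_upsets_Un: "\<lbrakk>U \<in> clopen_upsets X; V \<in> clopen_upsets X\<rbrakk> \<Longrightarrow> U \<union> V \<in> clopen_upsets X"
  by (auto simp: clopen_upsets_def up_def)

lemma clopen_upsets_Int: "\<lbrakk>U \<in> clopen_upsets X; V \<in> clopen_upsets X\<rbrakk> \<Longrightarrow> U \<inter> V \<in> clopen_upsets X"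
  by (auto simp: clopen_upsets_def up_def)

text \<open>This removes downsets from the description of the topology on \<open>C_obj X\<close>,
  leaving only clopen upsets, which are the elements that Box and Dia are applied to.\<close>

lemma clopen_downset_Compl:
  "S \<in> clopen_downsets X \<longleftrightarrow> S \<subseteq> points X \<and> points X - S \<in> clopen_upsets X"
proof
  assume S: "S \<in> clopen_downsets X"
  then show "S \<subseteq> points X \<and> points X - S \<in> clopen_upsets X"
    using ord_points by (auto simp: clopen_upsets_def clopen_downsets_def up_def down_def dest: closedin_subset)
next
  assume S: "S \<subseteq> points X \<and> points X - S \<in> clopen_upsets X"
  then have "points X - (points X - S) = S" by blast
  then have "openin (topo X) S" "closedin (topo X) S"
    using S clopen_upsetD(1,2)[of "points X - S"] by (metis closedin_def openin_closedin_eq)+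
  then show "S \<in> clopen_downsets X"
    using S ord_points clopen_upsetD(4)[of "points X - S"] by (auto simp: clopen_downsets_def down_def)
qed

lemma upset_separation:
  assumes "compactin (topo X) A" "compactin (topo X) B"
    and "\<And>a b. \<lbrakk>a \<in> A; b \<in> B\<rbrakk> \<Longrightarrow> (a, b) \<notin> ord X"
  shows "\<exists>U\<in>clopen_upsets X. A \<subseteq> U \<and> U \<inter> B = {}"
proof -
  have AB: "A \<subseteq> points X" "B \<subseteq> points X" using assms by (auto simp: compactin_def)
  have clopen: "openin (topo X) U \<and> closedin (topo X) U" if "U \<in> clopen_upsets X" for U
    using clopen_upsetD(1,2)[OF that] by simp
  have sep: "\<exists>U\<in>clopen_upsets X. a \<in> U \<and> b \<notin> U" if "a \<in> A" "b \<in> B" for a b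
    using ord_separates[of a b] assms(3)[of a b] AB that by auto
  show ?thesis
    by (rule compact_separation[of "topo X", OF assms(1,2) clopen clopen_upsets_empty
          clopen_upsets_points clopen_upsets_Un clopen_upsets_Int sep])
qed

text \<open>A clopen upset \<open>W\<close> and its complement are both compact, and no point of
  \<open>W\<close> lies below a point outside it. Separating these two sets inside the sublattice
  can only produce \<open>W\<close> itself.\<close>

lemma separating_sublattice:
  assumes sub: "\<U> \<subseteq> clopen_upsets X" and "{} \<in> \<U>" "points X \<in> \<U>"
    and "\<And>U V. \<lbrakk>U \<in> \<U>; V \<in> \<U>\<rbrakk> \<Longrightarrow> U \<union> V \<in> \<U>" "\<And>U V. \<lbrakk>U \<in> \<U>; V \<in> \<U>\<rbrakk> \<Longrightarrow> U \<inter> V \<in> \<U>"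
    and sep: "\<And>x y. \<lbrakk>x \<in> points X; y \<in> points X; (x, y) \<notin> ord X\<rbrakk> \<Longrightarrow> \<exists>U\<in>\<U>. x \<in> U \<and> y \<notin> U"
  shows "\<U> = clopen_upsets X"
proof
  show "clopen_upsets X \<subseteq> \<U>"
  proof
    fix W assume W: "W \<in> clopen_upsets X"
    note WD = clopen_upsetD[OF W]
    have W': "compactin (topo X) W" "compactin (topo X) (points X - W)"
      using WD compact closedin_compact_space by blast+
    have sepW: "\<exists>U\<in>\<U>. a \<in> U \<and> b \<notin> U" if "a \<in> W" "b \<in> points X - W" for a b
      using sep that WD(3,4) by blast
    have clopen: "openin (topo X) U \<and> closedin (topo X) U" if "U \<in> \<U>" for U
      using that sub clopen_upsetD(1,2)[of U] by auto
    have "\<exists>U\<in>\<U>. W \<subseteq> U \<and> U \<inter> (points X - W) = {}"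
      by (rule compact_separation[of "topo X", OF W' clopen assms(2-5) sepW])
    then obtain U where "U \<in> \<U>" "W \<subseteq> U" "U \<inter> (points X - W) = {}" by blast
    moreover have "U \<subseteq> points X" using sub clopen_upsetD(3) \<open>U \<in> \<U>\<close> by blast
    ultimately have "U = W" by blast
    then show "W \<in> \<U>" using \<open>U \<in> \<U>\<close> by simp
  qed
qed (rule sub)

lemma up_iff: "y \<in> up X A \<longleftrightarrow> (\<exists>x\<in>A. (x, y) \<in> ord X)"
  and down_iff: "y \<in> down X A \<longleftrightarrow> (\<exists>x\<in>A. (y, x) \<in> ord X)"
  by (auto simp: up_def down_def)

lemma compactin_singleton: "x \<in> points X \<Longrightarrow> compactin (topo X) {x}"
  by (simp add: finite_imp_compactin)

text \<open>A point outside the up-closure is separated from all of \<open>A\<close> by one clopen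
  upset containing \<open>A\<close>; the complement of that set is a neighbourhood missing the
  up-closure. With the dual statement this makes convex hulls of compact sets closed.\<close>

lemma closedin_up:
  assumes "compactin (topo X) A"
  shows "closedin (topo X) (up X A)"
proof -
  have "\<exists>T. openin (topo X) T \<and> y \<in> T \<and> T \<subseteq> points X - up X A" if y: "y \<in> points X - up X A" for y
  proof -
    obtain U where U: "U \<in> clopen_upsets X" "A \<subseteq> U" "U \<inter> {y} = {}"
      using upset_separation[OF assms compactin_singleton[of y]] y by (auto simp: up_iff)
    have "up X A \<subseteq> U" using U(2) clopen_upsetD(4)[OF U(1)] by (force simp: up_iff)
    then show ?thesis
      using U y clopen_upsetD(2)[OF U(1)] by (intro exI[of _ "points X - U"]) auto
  qed
  moreover have "up X A \<subseteq> points X" using ord_points by (auto simp: up_iff)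
  ultimately show ?thesis unfolding closedin_def using openin_subopen by metis
qed

lemma closedin_down:
  assumes "compactin (topo X) A"
  shows "closedin (topo X) (down X A)"
proof -
  have "\<exists>T. openin (topo X) T \<and> y \<in> T \<and> T \<subseteq> points X - down X A" if y: "y \<in> points X - down X A" for y
  proof -
    obtain U where U: "U \<in> clopen_upsets X" "{y} \<subseteq> U" "U \<inter> A = {}"
      using upset_separation[OF compactin_singleton[of y] assms] y by (auto simp: down_iff)
    have "down X A \<inter> U = {}" using U(3) clopen_upsetD(4)[OF U(1)] by (force simp: down_iff)
    then show ?thesis
      using U y clopen_upsetD(1,3)[OF U(1)] by (intro exI[of _ U]) auto
  qed
  moreover have "down X A \<subseteq> points X" using ord_points by (auto simp: down_iff)
  ultimately show ?thesis unfolding closedin_def using openin_subopen by metis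
qed

lemma CU_lattice:
  shows CU_DL: "DL_object (CU_obj X)"
    and CU_carrier: "carrier (CU_obj X) = clopen_upsets X" and CU_le: "U \<sqsubseteq>\<^bsub>CU_obj X\<^esub> V \<longleftrightarrow> U \<subseteq> V"
    and CU_join: "\<lbrakk>U \<in> clopen_upsets X; V \<in> clopen_upsets X\<rbrakk> \<Longrightarrow> U \<squnion>\<^bsub>CU_obj X\<^esub> V = U \<union> V"
    and CU_meet: "\<lbrakk>U \<in> clopen_upsets X; V \<in> clopen_upsets X\<rbrakk> \<Longrightarrow> U \<sqinter>\<^bsub>CU_obj X\<^esub> V = U \<inter> V"
    and CU_bottom: "\<bottom>\<^bsub>CU_obj X\<^esub> = {}" and CU_top: "\<top>\<^bsub>CU_obj X\<^esub> = points X"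
proof -
  show c: "carrier (CU_obj X) = clopen_upsets X" and le: "U \<sqsubseteq>\<^bsub>CU_obj X\<^esub> V \<longleftrightarrow> U \<subseteq> V" for U V
    by (simp_all add: CU_obj_def)
  have "bounded_distributive_lattice (CU_obj X) \<and>
     (\<forall>U\<in>clopen_upsets X. \<forall>V\<in>clopen_upsets X. U \<squnion>\<^bsub>CU_obj X\<^esub> V = U \<union> V) \<and>
     (\<forall>U\<in>clopen_upsets X. \<forall>V\<in>clopen_upsets X. U \<sqinter>\<^bsub>CU_obj X\<^esub> V = U \<inter> V) \<and>
     \<bottom>\<^bsub>CU_obj X\<^esub> = {} \<and> \<top>\<^bsub>CU_obj X\<^esub> = points X"
    unfolding c[symmetric]
    by (intro conjI ballI bounded_distributive_latticeI[where j = "(\<union>)" and m = "(\<inter>)" and b = "{}" and t = "points X"])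
      (auto simp: c le CU_obj_def[of X] clopen_upsets_Un clopen_upsets_Int clopen_upsets_empty
        clopen_upsets_points dest: clopen_upsetD(3))
  then show "DL_object (CU_obj X)"
    and "\<lbrakk>U \<in> clopen_upsets X; V \<in> clopen_upsets X\<rbrakk> \<Longrightarrow> U \<squnion>\<^bsub>CU_obj X\<^esub> V = U \<union> V"
    and "\<lbrakk>U \<in> clopen_upsets X; V \<in> clopen_upsets X\<rbrakk> \<Longrightarrow> U \<sqinter>\<^bsub>CU_obj X\<^esub> V = U \<inter> V"
    and "\<bottom>\<^bsub>CU_obj X\<^esub> = {}" and "\<top>\<^bsub>CU_obj X\<^esub> = points X" for U V
    by (simp_all add: DL_object_def)
qed

end

section \<open>Functoriality of clopen upsets\<close>

lemma PS_homD:
  assumes "g \<in> PS_hom X Y"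
  shows "g \<in> extensional (points X)" "continuous_map (topo X) (topo Y) g"
    and "\<And>x. x \<in> points X \<Longrightarrow> g x \<in> points Y"
    and "\<And>x y. (x, y) \<in> ord X \<Longrightarrow> (g x, g y) \<in> ord Y"
  using assms by (auto simp: PS_hom_def continuous_map_def)

lemma CU_map_upset:
  assumes "priestley X" "priestley Y" and g: "g \<in> PS_hom X Y" and U: "U \<in> clopen_upsets Y"
  shows "{x \<in> points X. g x \<in> U} \<in> clopen_upsets X"
proof -
  interpret X: priestley X by fact
  interpret Y: priestley Y by fact
  note g = PS_homD[OF g] and U = Y.clopen_upsetD[OF U]
  show ?thesis
    using openin_continuous_map_preimage[OF g(2) U(1)] closedin_continuous_map_preimage[OF g(2) U(2)]
      U(4) g(4) X.ord_points by (auto simp: clopen_upsets_def up_def)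
qed

lemma CU_map_hom:
  assumes "priestley X" "priestley Y" and g: "g \<in> PS_hom X Y"
  shows "CU_map X Y g \<in> DL_hom (CU_obj Y) (CU_obj X)"
proof -
  interpret X: priestley X by fact
  interpret Y: priestley Y by fact
  note up = CU_map_upset[OF assms]
  show ?thesis
  proof (rule DL_homI[OF Y.CU_DL X.CU_DL])
    show "CU_map X Y g \<in> carrier (CU_obj Y) \<rightarrow>\<^sub>E carrier (CU_obj X)"
      using up by (auto simp: CU_map_def X.CU_carrier Y.CU_carrier)
  next
    fix U V assume "U \<in> carrier (CU_obj Y)" "V \<in> carrier (CU_obj Y)"
    then show "CU_map X Y g (U \<squnion>\<^bsub>CU_obj Y\<^esub> V) = CU_map X Y g U \<squnion>\<^bsub>CU_obj X\<^esub> CU_map X Y g V"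
      "CU_map X Y g (U \<sqinter>\<^bsub>CU_obj Y\<^esub> V) = CU_map X Y g U \<sqinter>\<^bsub>CU_obj X\<^esub> CU_map X Y g V"
      by (auto simp: CU_map_def Y.CU_carrier Y.CU_join Y.CU_meet X.CU_join X.CU_meet up
          Y.clopen_upsets_Un Y.clopen_upsets_Int)
  next
    show "CU_map X Y g \<bottom>\<^bsub>CU_obj Y\<^esub> = \<bottom>\<^bsub>CU_obj X\<^esub>" "CU_map X Y g \<top>\<^bsub>CU_obj Y\<^esub> = \<top>\<^bsub>CU_obj X\<^esub>"
      using PS_homD(3)[OF g]
      by (auto simp: CU_map_def X.CU_bottom Y.CU_bottom X.CU_top Y.CU_top Y.clopen_upsets_empty
          Y.clopen_upsets_points)
  qed
qed

lemma CU_map_id: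
  assumes "priestley X"
  shows "CU_map X X (restrict id (points X)) = restrict id (carrier (CU_obj X))"
proof -
  interpret X: priestley X by fact
  show ?thesis
    using X.clopen_upsetD(3) by (auto simp: fun_eq_iff CU_map_def X.CU_carrier)
qed

lemma CU_map_compose:
  assumes "priestley X" "priestley Y" "priestley Z" "f \<in> PS_hom X Y" "g \<in> PS_hom Y Z"
  shows "CU_map X Z (compose (points X) g f)
       = compose (carrier (CU_obj Z)) (CU_map X Y f) (CU_map Y Z g)"
proof -
  interpret Z: priestley Z by fact
  show ?thesis
    using CU_map_upset[OF assms(2,3,5)] PS_homD(3)[OF assms(4)]
    by (auto simp: fun_eq_iff CU_map_def compose_def restrict_def Z.CU_carrier)
qed

section \<open>The space of closed convex sets\<close>

definition dia_set :: "'a ordered_space \<Rightarrow> 'a set \<Rightarrow> 'a set set" where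
  "dia_set X U = {C \<in> convex_closed_sets X. C \<inter> U \<noteq> {}}"

text \<open>For a clopen upset \<open>U\<close> this is the subbasic set of those \<open>C\<close>
  that miss the clopen downset \<open>points X - U\<close>.\<close>

definition box_set :: "'a ordered_space \<Rightarrow> 'a set \<Rightarrow> 'a set set" where
  "box_set X U = {C \<in> convex_closed_sets X. C \<subseteq> U}"

lemma convex_closedD:
  assumes "C \<in> convex_closed_sets X" "x \<in> C" "y \<in> C" "(x, z) \<in> ord X" "(z, y) \<in> ord X"
  shows "z \<in> C"
  by (rule CollectD[OF assms(1)[unfolded convex_closed_sets_def], THEN conjunct2, rule_format,
        OF assms(2,3) conjI[OF assms(4,5)]])

context priestley
begin

lemma convex_closed_points: "C \<in> convex_closed_sets X \<Longrightarrow> C \<subseteq> points X"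
  by (auto simp: convex_closed_sets_def dest: closedin_subset)

lemma convex_closed_compact: "C \<in> convex_closed_sets X \<Longrightarrow> compactin (topo X) C"
  by (auto simp: convex_closed_sets_def intro: closedin_compact_space compact)

lemma points_C: "points (C_obj X) = convex_closed_sets X"
  using clopen_upsets_empty by (auto simp: C_obj_def)

text \<open>Clopen downsets are the complements of clopen upsets, and meeting such a complement is
  the negation of being contained in the upset. The subbasis thus consists of the interpretations of
  Dia and Box together with their complements.\<close>

lemma C_topology:
  "topo (C_obj X) = topology_generated_by (\<Union>U\<in>clopen_upsets X.
     {dia_set X U, convex_closed_sets X - dia_set X U, box_set X U, convex_closed_sets X - box_set X U})"
    (is "_ = topology_generated_by ?G")
proof -
  let ?dia = "\<lambda>S. {C \<in> convex_closed_sets X. C \<inter> S \<noteq> {}}"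
  let ?ndia = "\<lambda>S. {C \<in> convex_closed_sets X. C \<inter> S = {}}"
  have up: "?dia S = dia_set X S" "?ndia S = convex_closed_sets X - dia_set X S" for S
    by (auto simp: dia_set_def)
  have down: "?dia (points X - U) = convex_closed_sets X - box_set X U" "?ndia (points X - U) = box_set X U"
    for U using convex_closed_points by (auto simp: box_set_def)
  have "clopen_downsets X = (-) (points X) ` clopen_upsets X"
  proof (intro equalityI subsetI)
    fix S assume "S \<in> clopen_downsets X"
    then have "points X - S \<in> clopen_upsets X" "S = points X - (points X - S)"
      by (auto simp: clopen_downset_Compl)
    then show "S \<in> (-) (points X) ` clopen_upsets X" by blast
  next
    fix S assume "S \<in> (-) (points X) ` clopen_upsets X"
    then show "S \<in> clopen_downsets X"
      using clopen_upsetD(3) by (auto simp: clopen_downset_Compl double_diff)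
  qed
  then have "(\<Union>S\<in>clopen_upsets X \<union> clopen_downsets X. {?dia S, ?ndia S}) = 
     (\<Union>U\<in>clopen_upsets X. {?dia U, ?ndia U} \<union> {?dia (points X - U), ?ndia (points X - U)})"
    by (simp only: UN_Un UN_Un_distrib SUP_image comp_def)
  also have "\<dots> = ?G"
  proof -
    have "{a, b} \<union> {c, d} = {a, b, d, c}" for a b c d :: "'a set set" by auto
    then show ?thesis unfolding down unfolding up by simp
  qed
  finally show ?thesis by (simp add: C_obj_def)
qed

lemma C_clopen:
  assumes "U \<in> clopen_upsets X"
  shows "openin (topo (C_obj X)) (dia_set X U)" "closedin (topo (C_obj X)) (dia_set X U)"
    "openin (topo (C_obj X)) (box_set X U)" "closedin (topo (C_obj X)) (box_set X U)"
proof -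
  have "openin (topo (C_obj X)) G" if "G \<in> {dia_set X U, convex_closed_sets X - dia_set X U,
      box_set X U, convex_closed_sets X - box_set X U}" for G
    unfolding C_topology using assms that by (intro topology_generated_by_Basis) blast
  then show "openin (topo (C_obj X)) (dia_set X U)" "closedin (topo (C_obj X)) (dia_set X U)"
    "openin (topo (C_obj X)) (box_set X U)" "closedin (topo (C_obj X)) (box_set X U)"
    by (auto simp: closedin_def points_C dia_set_def box_set_def)
qed

text \<open>Asking for clopen preimages of the Dia and Box sets takes care of the complementary
  generators at once.\<close>

lemma continuous_into_C:
  assumes maps: "f \<in> topspace T \<rightarrow> convex_closed_sets X"
    and dia: "\<And>U. U \<in> clopen_upsets X \<Longrightarrow> \<exists>W. openin T W \<and> closedin T W \<and> (\<forall>x\<in>topspace T. f x \<inter> U \<noteq> {} \<longleftrightarrow> x \<in> W)"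
    and box: "\<And>U. U \<in> clopen_upsets X \<Longrightarrow> \<exists>W. openin T W \<and> closedin T W \<and> (\<forall>x\<in>topspace T. f x \<subseteq> U \<longleftrightarrow> x \<in> W)"
  shows "continuous_map T (topo (C_obj X)) f"
  unfolding C_topology
proof (rule continuous_on_generated_topo)
  show "f ` topspace T \<subseteq> \<Union> (\<Union>U\<in>clopen_upsets X.
     {dia_set X U, convex_closed_sets X - dia_set X U, box_set X U, convex_closed_sets X - box_set X U})"
    using maps clopen_upsets_empty by blast
  fix G assume "G \<in> (\<Union>U\<in>clopen_upsets X.
     {dia_set X U, convex_closed_sets X - dia_set X U, box_set X U, convex_closed_sets X - box_set X U})"
  then obtain U where U: "U \<in> clopen_upsets X" and G: "G = dia_set X U \<or>
     G = convex_closed_sets X - dia_set X U \<or> G = box_set X U \<or> G = convex_closed_sets X - box_set X U"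
    by blast
  obtain V W where V: "openin T V" "closedin T V" "\<And>x. x\<in>topspace T \<Longrightarrow> f x \<inter> U \<noteq> {} \<longleftrightarrow> x \<in> V"
    and W: "openin T W" "closedin T W" "\<And>x. x\<in>topspace T \<Longrightarrow> f x \<subseteq> U \<longleftrightarrow> x \<in> W"
    using dia[OF U] box[OF U] by meson
  have sub: "V \<subseteq> topspace T" "W \<subseteq> topspace T" using V W by (auto dest: openin_subset)
  have "f -` dia_set X U \<inter> topspace T = V"
    "f -` (convex_closed_sets X - dia_set X U) \<inter> topspace T = topspace T - V"
    using maps V(3) sub by (auto simp: dia_set_def)
  moreover have "f -` box_set X U \<inter> topspace T = W"
    "f -` (convex_closed_sets X - box_set X U) \<inter> topspace T = topspace T - W"
    using maps W(3) sub by (auto simp: box_set_def)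
  ultimately show "openin T (f -` G \<inter> topspace T)"
    using G V W by (elim disjE) (simp_all add: closedin_def)
qed

text \<open>The Egli-Milner order is the order of tests by clopen upsets. If some \<open>c\<close>
  in \<open>C\<close> lies below no point of \<open>D\<close>, separating \<open>c\<close> from the
  compact set \<open>D\<close> gives a violated Dia test; if some \<open>d\<close> in
  \<open>D\<close> lies above no point of \<open>C\<close>, separating \<open>C\<close> from
  \<open>d\<close> gives a violated Box test.\<close>

lemma C_ord_iff:
  assumes C: "C \<in> convex_closed_sets X" and D: "D \<in> convex_closed_sets X"
  shows "(C, D) \<in> ord (C_obj X) \<longleftrightarrow>
    (\<forall>U\<in>clopen_upsets X. (C \<inter> U \<noteq> {} \<longrightarrow> D \<inter> U \<noteq> {}) \<and> (C \<subseteq> U \<longrightarrow> D \<subseteq> U))" (is "?l \<longleftrightarrow> ?r")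
proof
  assume ?l
  then have CD: "C \<subseteq> down X D" "D \<subseteq> up X C" by (auto simp: C_obj_def)
  show ?r
  proof (intro ballI conjI impI)
    fix U assume U: "U \<in> clopen_upsets X"
    show "D \<inter> U \<noteq> {}" if ne: "C \<inter> U \<noteq> {}"
    proof -
      obtain c where c: "c \<in> C" "c \<in> U" using ne by blast
      then obtain d where "d \<in> D" "(c, d) \<in> ord X" using CD(1) down_iff by blast
      then show ?thesis using clopen_upsetD(4)[OF U c(2)] by blast
    qed
    show "D \<subseteq> U" if "C \<subseteq> U"
    proof
      fix d assume "d \<in> D"
      then obtain c where "c \<in> C" "(c, d) \<in> ord X" using CD(2) up_iff by blast
      then show "d \<in> U" using clopen_upsetD(4)[OF U, of c d] that by blast
    qed
  qed
next
  assume r: ?r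
  have "c \<in> down X D" if c: "c \<in> C" for c
  proof (rule ccontr)
    assume "c \<notin> down X D"
    then obtain U where U: "U \<in> clopen_upsets X" "{c} \<subseteq> U" "U \<inter> D = {}"
      using upset_separation[OF compactin_singleton[of c] convex_closed_compact[OF D]]
        convex_closed_points[OF C] c by (auto simp: down_iff)
    with bspec[OF r U(1)] show False using c by auto
  qed
  moreover have "d \<in> up X C" if d: "d \<in> D" for d
  proof (rule ccontr)
    assume "d \<notin> up X C"
    then obtain U where U: "U \<in> clopen_upsets X" "C \<subseteq> U" "U \<inter> {d} = {}"
      using upset_separation[OF convex_closed_compact[OF C] compactin_singleton[of d]]
        convex_closed_points[OF D] d by (auto simp: up_iff)
    with bspec[OF r U(1)] show False using d by auto
  qed
  ultimately show ?l using C D by (auto simp: C_obj_def)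
qed

lemma C_ord_convex:
  "(C, D) \<in> ord (C_obj X) \<Longrightarrow> C \<in> convex_closed_sets X \<and> D \<in> convex_closed_sets X"
  by (simp add: C_obj_def)

text \<open>Each point of one set lies between two points of the other, hence belongs to it by
  convexity.\<close>

lemma C_ord_antisym:
  assumes "(C, D) \<in> ord (C_obj X)" "(D, C) \<in> ord (C_obj X)"
  shows "C = D"
proof -
  have "C \<subseteq> D" if CD: "(C, D) \<in> ord (C_obj X)" "(D, C) \<in> ord (C_obj X)" for C D
  proof
    fix c assume "c \<in> C"
    then obtain x y where "x \<in> D" "(c, x) \<in> ord X" "y \<in> D" "(y, c) \<in> ord X"
      using CD by (force simp: C_obj_def up_iff down_iff)
    then show "c \<in> D" using convex_closedD[of D X y x c] CD by (simp add: C_obj_def)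
  qed
  then show ?thesis using assms by blast
qed

lemma dia_set_upset: "U \<in> clopen_upsets X \<Longrightarrow> dia_set X U \<in> clopen_upsets (C_obj X)"
  and box_set_upset: "U \<in> clopen_upsets X \<Longrightarrow> box_set X U \<in> clopen_upsets (C_obj X)"
proof -
  assume U: "U \<in> clopen_upsets X"
  have "C \<in> dia_set X U \<longrightarrow> D \<in> dia_set X U" "C \<in> box_set X U \<longrightarrow> D \<in> box_set X U"
    if "(C, D) \<in> ord (C_obj X)" for C D
    using that C_ord_convex[OF that] C_ord_iff[of C D] U by (auto simp: dia_set_def box_set_def)
  then have "up (C_obj X) (dia_set X U) \<subseteq> dia_set X U" "up (C_obj X) (box_set X U) \<subseteq> box_set X U"
    unfolding up_def by blast+
  then show "dia_set X U \<in> clopen_upsets (C_obj X)" "box_set X U \<in> clopen_upsets (C_obj X)"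
    using C_clopen[OF U] by (simp_all add: clopen_upsets_def[of "C_obj X"])
qed

lemma C_ord_separates:
  assumes "C \<in> convex_closed_sets X" "D \<in> convex_closed_sets X" "(C, D) \<notin> ord (C_obj X)"
  shows "\<exists>U\<in>clopen_upsets X. C \<in> dia_set X U \<and> D \<notin> dia_set X U \<or> C \<in> box_set X U \<and> D \<notin> box_set X U"
  using assms C_ord_iff[of C D] by (auto simp: dia_set_def box_set_def)

text \<open>Compactness stays a hypothesis here; it is discharged in \<open>priestley_C_obj\<close>,
  where \<open>C_obj X\<close> is seen to be an image of a compact space.\<close>

lemma priestley_C:
  assumes "compact_space (topo (C_obj X))"
  shows "priestley_space (C_obj X)"
  unfolding priestley_space_def
proof (intro conjI ballI impI assms)
  have "(C, C) \<in> ord (C_obj X)" if "C \<in> convex_closed_sets X" for C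
    using C_ord_iff[OF that that] by blast
  moreover have "(C, E) \<in> ord (C_obj X)" if "(C, D) \<in> ord (C_obj X)" "(D, E) \<in> ord (C_obj X)" for C D E
    using that C_ord_convex[OF that(1)] C_ord_convex[OF that(2)] C_ord_iff by simp
  moreover have "ord (C_obj X) \<subseteq> convex_closed_sets X \<times> convex_closed_sets X"
    by (auto simp: C_obj_def)
  ultimately show "partial_order_on (points (C_obj X)) (ord (C_obj X))"
    unfolding points_C order_on_defs refl_on_def trans_def antisym_def using C_ord_antisym by blast
next
  fix C D assume "C \<in> points (C_obj X)" "D \<in> points (C_obj X)" "(C, D) \<notin> ord (C_obj X)"
  then obtain U where "U \<in> clopen_upsets X"
    "C \<in> dia_set X U \<and> D \<notin> dia_set X U \<or> C \<in> box_set X U \<and> D \<notin> box_set X U"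
    using C_ord_separates by (auto simp: points_C)
  then show "\<exists>U\<in>clopen_upsets (C_obj X). C \<in> U \<and> D \<notin> U"
    using dia_set_upset box_set_upset by blast
qed

lemma subset_convex_closure: "A \<subseteq> points X \<Longrightarrow> A \<subseteq> convex_closure X A"
  using ord_refl by (force simp: convex_closure_def up_iff down_iff)

lemma convex_closure_convex_closed:
  assumes "compactin (topo X) A"
  shows "convex_closure X A \<in> convex_closed_sets X"
proof -
  have "z \<in> up X A \<inter> down X A"
    if "x \<in> up X A \<inter> down X A" "y \<in> up X A \<inter> down X A" "(x, z) \<in> ord X" "(z, y) \<in> ord X" for x y z
    using that unfolding Int_iff up_iff down_iff by (meson ord_trans)
  then show ?thesis
    using closedin_Int[OF closedin_up[OF assms] closedin_down[OF assms]]
    unfolding convex_closure_def convex_closed_sets_def mem_Collect_eq by meson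
qed

lemma convex_closure_idem:
  assumes "C \<in> convex_closed_sets X"
  shows "convex_closure X C = C"
proof
  show "C \<subseteq> convex_closure X C" by (rule subset_convex_closure[OF convex_closed_points[OF assms]])
  show "convex_closure X C \<subseteq> C"
  proof
    fix z assume "z \<in> convex_closure X C"
    then obtain x y where "x \<in> C" "(x, z) \<in> ord X" "y \<in> C" "(z, y) \<in> ord X"
      unfolding convex_closure_def Int_iff up_iff down_iff by (elim conjE bexE)
    then show "z \<in> C" using convex_closedD[OF assms, of x y z] by simp
  qed
qed

text \<open>A down-closure meets an upset only if the original set does, and dually an up-closure
  stays inside an upset that contains the original set. Hence neither this test nor the one in
  \<open>convex_closure_box\<close> notices the hull.\<close>

lemma convex_closure_dia:
  assumes "A \<subseteq> points X" "U \<in> clopen_upsets X"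
  shows "convex_closure X A \<inter> U \<noteq> {} \<longleftrightarrow> A \<inter> U \<noteq> {}"
proof -
  have "down X A \<inter> U \<noteq> {} \<Longrightarrow> A \<inter> U \<noteq> {}"
    using clopen_upsetD(4)[OF assms(2)] by (force simp: down_iff)
  then show ?thesis using subset_convex_closure[OF assms(1)] unfolding convex_closure_def by blast
qed

lemma convex_closure_box:
  assumes "A \<subseteq> points X" "U \<in> clopen_upsets X"
  shows "convex_closure X A \<subseteq> U \<longleftrightarrow> A \<subseteq> U"
proof -
  have "A \<subseteq> U \<Longrightarrow> up X A \<subseteq> U"
    using clopen_upsetD(4)[OF assms(2)] by (force simp: up_iff)
  then show ?thesis using subset_convex_closure[OF assms(1)] unfolding convex_closure_def by blast
qed

end

section \<open>Functoriality of closed convex sets\<close>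

context
  fixes X :: "'a ordered_space" and Y :: "'b ordered_space" and f
  assumes X: "priestley X" and Y: "priestley Y" and f: "f \<in> PS_hom X Y"
begin

interpretation X: priestley X by (rule X)
interpretation Y: priestley Y by (rule Y)

lemma C_map_convex_closed:
  assumes "C \<in> convex_closed_sets X"
  shows "C_map X Y f C \<in> convex_closed_sets Y"
  using Y.convex_closure_convex_closed[OF image_compactin[OF X.convex_closed_compact[OF assms] PS_homD(2)[OF f]]]
    assms by (simp add: C_map_def)

lemma C_map_dia:
  assumes "C \<in> convex_closed_sets X" "U \<in> clopen_upsets Y"
  shows "C_map X Y f C \<inter> U \<noteq> {} \<longleftrightarrow> C \<inter> {x \<in> points X. f x \<in> U} \<noteq> {}"
proof -
  have "f ` C \<subseteq> points Y" using X.convex_closed_points[OF assms(1)] PS_homD(3)[OF f] by blast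
  then show ?thesis
    using Y.convex_closure_dia[OF _ assms(2), of "f ` C"] X.convex_closed_points[OF assms(1)] assms(1)
    by (auto simp: C_map_def)
qed

lemma C_map_box:
  assumes "C \<in> convex_closed_sets X" "U \<in> clopen_upsets Y"
  shows "C_map X Y f C \<subseteq> U \<longleftrightarrow> C \<subseteq> {x \<in> points X. f x \<in> U}"
proof -
  have "f ` C \<subseteq> points Y" using X.convex_closed_points[OF assms(1)] PS_homD(3)[OF f] by blast
  then show ?thesis
    using Y.convex_closure_box[OF _ assms(2), of "f ` C"] X.convex_closed_points[OF assms(1)] assms(1)
    by (auto simp: C_map_def)
qed

text \<open>Testing the image of \<open>C\<close> by a clopen upset amounts to testing
  \<open>C\<close> by its preimage. Continuity then follows from \<open>continuous_into_C\<close>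
  and monotonicity from \<open>C_ord_iff\<close>.\<close>

lemma C_map_hom: "C_map X Y f \<in> PS_hom (C_obj X) (C_obj Y)"
proof -
  have "continuous_map (topo (C_obj X)) (topo (C_obj Y)) (C_map X Y f)"
  proof (rule Y.continuous_into_C)
    show "C_map X Y f \<in> points (C_obj X) \<rightarrow> convex_closed_sets Y"
      using C_map_convex_closed by (simp add: X.points_C)
    fix U assume U: "U \<in> clopen_upsets Y"
    let ?V = "{x \<in> points X. f x \<in> U}"
    note V = CU_map_upset[OF X Y f U]
    show "\<exists>W. openin (topo (C_obj X)) W \<and> closedin (topo (C_obj X)) W \<and>
        (\<forall>C\<in>points (C_obj X). C_map X Y f C \<inter> U \<noteq> {} \<longleftrightarrow> C \<in> W)"
      using X.C_clopen[OF V] C_map_dia[OF _ U]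
      by (intro exI[of _ "dia_set X ?V"]) (simp add: X.points_C dia_set_def)
    show "\<exists>W. openin (topo (C_obj X)) W \<and> closedin (topo (C_obj X)) W \<and>
        (\<forall>C\<in>points (C_obj X). C_map X Y f C \<subseteq> U \<longleftrightarrow> C \<in> W)"
      using X.C_clopen[OF V] C_map_box[OF _ U]
      by (intro exI[of _ "box_set X ?V"]) (simp add: X.points_C box_set_def)
  qed
  moreover have "(C_map X Y f C, C_map X Y f D) \<in> ord (C_obj Y)" if CD: "(C, D) \<in> ord (C_obj X)" for C D
  proof -
    have c: "C \<in> convex_closed_sets X" "D \<in> convex_closed_sets X" using CD by (auto simp: C_obj_def)
    show ?thesis
      using CD CU_map_upset[OF X Y f] C_map_convex_closed c
      by (simp add: Y.C_ord_iff X.C_ord_iff C_map_dia C_map_box)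
  qed
  ultimately show ?thesis
    by (simp add: PS_hom_def X.points_C) (simp add: C_map_def)
qed

end

lemma C_map_id:
  assumes "priestley X"
  shows "C_map X X (restrict id (points X)) = restrict id (points (C_obj X))"
proof -
  interpret X: priestley X by fact
  have "restrict id (points X) ` C = C" if "C \<in> convex_closed_sets X" for C
    using X.convex_closed_points[OF that] by force
  then show ?thesis
    using X.convex_closure_idem by (simp add: fun_eq_iff C_map_def X.points_C)
qed

lemma C_map_compose:
  assumes "priestley X" "priestley Y" "priestley Z" and f: "f \<in> PS_hom X Y" and g: "g \<in> PS_hom Y Z"
  shows "C_map X Z (compose (points X) g f)
       = compose (points (C_obj X)) (C_map Y Z g) (C_map X Y f)"
proof -
  interpret X: priestley X by fact
  interpret Y: priestley Y by fact
  interpret Z: priestley Z by fact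
  have "convex_closure Z (compose (points X) g f ` C) = convex_closure Z (g ` convex_closure Y (f ` C))"
    if C: "C \<in> convex_closed_sets X" for C
  proof -
    have im: "compose (points X) g f ` C = g ` f ` C"
      using X.convex_closed_points[OF C] by (force simp: compose_def)
    have fC: "f ` C \<subseteq> convex_closure Y (f ` C)"
      using Y.subset_convex_closure X.convex_closed_points[OF C] PS_homD(3)[OF f] by blast
    \<comment> \<open>A point above \<open>g w\<close>, where \<open>w\<close> lies above some
      \<open>a\<close> in \<open>A\<close>, is above \<open>g a\<close> because \<open>g\<close> is
      monotone; dually below. So the inner hull adds nothing to the outer one.\<close>
    have "up Z (g ` convex_closure Y A) \<subseteq> up Z (g ` A)" "down Z (g ` convex_closure Y A) \<subseteq> down Z (g ` A)" for A
      using PS_homD(4)[OF g] Z.ord_trans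
      by (fastforce simp: Z.up_iff Z.down_iff Y.up_iff Y.down_iff convex_closure_def)+
    moreover have "up Z (g ` f ` C) \<subseteq> up Z (g ` convex_closure Y (f ` C))"
      "down Z (g ` f ` C) \<subseteq> down Z (g ` convex_closure Y (f ` C))"
      using fC unfolding up_def down_def by blast+
    ultimately show ?thesis unfolding im convex_closure_def[of Z] by blast
  qed
  moreover have "C_map X Y f C = convex_closure Y (f ` C)" "C_map X Y f C \<in> convex_closed_sets Y"
    if "C \<in> convex_closed_sets X" for C
    using that C_map_convex_closed[OF assms(1,2) f that] by (simp_all add: C_map_def)
  ultimately show ?thesis
    by (simp add: fun_eq_iff C_map_def compose_def X.points_C)
qed

section \<open>The lattice of modal terms\<close>

text \<open>The term congruence supplies equations, whereas HOL-Algebra asks for an order with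
  bounds. This rule recovers the order-theoretic laws from the equations, the order being given by
  \<open>j x y = y\<close>.\<close>

lemma bounded_distributive_lattice_equationalI:
  fixes L (structure)
  assumes eq: "(.=) = (=)"
    and le: "\<And>x y. \<lbrakk>x \<in> carrier L; y \<in> carrier L\<rbrakk> \<Longrightarrow> x \<sqsubseteq> y \<longleftrightarrow> j x y = y"
    and closed: "\<And>x y. \<lbrakk>x \<in> carrier L; y \<in> carrier L\<rbrakk> \<Longrightarrow> j x y \<in> carrier L"
      "\<And>x y. \<lbrakk>x \<in> carrier L; y \<in> carrier L\<rbrakk> \<Longrightarrow> m x y \<in> carrier L" "b \<in> carrier L" "t \<in> carrier L"
    and j_assoc: "\<And>x y z. \<lbrakk>x \<in> carrier L; y \<in> carrier L; z \<in> carrier L\<rbrakk> \<Longrightarrow> j (j x y) z = j x (j y z)"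
    and m_assoc: "\<And>x y z. \<lbrakk>x \<in> carrier L; y \<in> carrier L; z \<in> carrier L\<rbrakk> \<Longrightarrow> m (m x y) z = m x (m y z)"
    and j_comm: "\<And>x y. \<lbrakk>x \<in> carrier L; y \<in> carrier L\<rbrakk> \<Longrightarrow> j x y = j y x"
    and m_comm: "\<And>x y. \<lbrakk>x \<in> carrier L; y \<in> carrier L\<rbrakk> \<Longrightarrow> m x y = m y x"
    and j_absorb: "\<And>x y. \<lbrakk>x \<in> carrier L; y \<in> carrier L\<rbrakk> \<Longrightarrow> j x (m x y) = x"
    and m_absorb: "\<And>x y. \<lbrakk>x \<in> carrier L; y \<in> carrier L\<rbrakk> \<Longrightarrow> m x (j x y) = x"
    and dist: "\<And>x y z. \<lbrakk>x \<in> carrier L; y \<in> carrier L; z \<in> carrier L\<rbrakk> \<Longrightarrow> m x (j y z) = j (m x y) (m x z)"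
    and b: "\<And>x. x \<in> carrier L \<Longrightarrow> j x b = x" and t: "\<And>x. x \<in> carrier L \<Longrightarrow> m x t = x"
  shows "bounded_distributive_lattice L"
    and "\<And>x y. \<lbrakk>x \<in> carrier L; y \<in> carrier L\<rbrakk> \<Longrightarrow> x \<squnion> y = j x y"
    and "\<And>x y. \<lbrakk>x \<in> carrier L; y \<in> carrier L\<rbrakk> \<Longrightarrow> x \<sqinter> y = m x y"
    and "\<bottom> = b" and "\<top> = t"
proof -
  \<comment> \<open>Idempotence comes from the two absorption laws together:
    \<open>m x (j x x)\<close> equals \<open>x\<close>, and absorbing it into \<open>x\<close> gives
    \<open>j x x = x\<close>.\<close>
  have idem: "j x x = x" if "x \<in> carrier L" for x
    using j_absorb[OF that closed(1)[OF that that]] m_absorb[OF that that] by simp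
  have ub: "x \<sqsubseteq> j x y" "y \<sqsubseteq> j x y" if "x \<in> carrier L" "y \<in> carrier L" for x y
    using that j_assoc[of x x y] j_assoc[of y y x] idem j_comm[of x y] by (simp_all add: le closed)
  have lb: "m x y \<sqsubseteq> x" "m x y \<sqsubseteq> y" if "x \<in> carrier L" "y \<in> carrier L" for x y
    using that j_absorb[of x y] j_absorb[of y x] j_comm[of "m x y" x] j_comm[of "m x y" y] m_comm[of x y]
    by (simp_all add: le closed)
  have least: "j x y \<sqsubseteq> z"
    if "x \<in> carrier L" "y \<in> carrier L" "z \<in> carrier L" "x \<sqsubseteq> z" "y \<sqsubseteq> z" for x y z
    using that by (simp add: le closed j_assoc)
  have meet_eq: "m z x = z" if "x \<in> carrier L" "z \<in> carrier L" "z \<sqsubseteq> x" for x z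
    using that m_absorb[of z x] by (simp add: le)
  have greatest: "z \<sqsubseteq> m x y"
    if "x \<in> carrier L" "y \<in> carrier L" "z \<in> carrier L" "z \<sqsubseteq> x" "z \<sqsubseteq> y" for x y z
  proof -
    have "m z (m x y) = z"
      using that m_assoc[of z x y] meet_eq[of x z] meet_eq[of y z] by simp
    then show ?thesis using lb(2)[of z "m x y"] that by (simp add: closed)
  qed
  have trans: "x \<sqsubseteq> z"
    if "x \<sqsubseteq> y" "y \<sqsubseteq> z" "x \<in> carrier L" "y \<in> carrier L" "z \<in> carrier L" for x y z
    using that j_assoc[of x y z] by (simp add: le)
  have antisym: "x = y" if "x \<sqsubseteq> y" "y \<sqsubseteq> x" "x \<in> carrier L" "y \<in> carrier L" for x y
    using that j_comm[of x y] by (simp add: le)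
  have bl: "b \<sqsubseteq> x" "x \<sqsubseteq> t" if "x \<in> carrier L" for x
    using that closed b[of x] t[of x] j_comm[of b x] lb(2)[of x t] by (simp_all add: le)
  have rf: "x \<sqsubseteq> x" if "x \<in> carrier L" for x using that idem by (simp add: le)
  have j: "j x y \<in> carrier L \<and> x \<sqsubseteq> j x y \<and> y \<sqsubseteq> j x y"
    and m: "m x y \<in> carrier L \<and> m x y \<sqsubseteq> x \<and> m x y \<sqsubseteq> y"
    if "x \<in> carrier L" "y \<in> carrier L" for x y
    using that ub lb closed by simp_all
  note I = bounded_distributive_latticeI[where L = L and j = j and m = m and b = b and t = t]
  note facts = eq rf antisym trans j least m greatest closed(3) bl(1) closed(4) bl(2) dist
  show "bounded_distributive_lattice L" by (rule I(1)) (fact facts)+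
  show "\<bottom> = b" by (rule I(4)) (fact facts)+
  show "\<top> = t" by (rule I(5)) (fact facts)+
  show "x \<squnion> y = j x y" "x \<sqinter> y = m x y" if xy: "x \<in> carrier L" "y \<in> carrier L" for x y
    by (rule I(2); fact facts xy) (rule I(3); fact facts xy)
qed

definition modal_class :: "'a gorder \<Rightarrow> 'a modal_term \<Rightarrow> 'a modal_term set" where
  "modal_class L t = modal_cong L `` {t}"

lemma modal_terms_simps [simp]:
  "Dia a \<in> modal_terms L \<longleftrightarrow> a \<in> carrier L" "Box a \<in> modal_terms L \<longleftrightarrow> a \<in> carrier L"
  "TBot \<in> modal_terms L" "TTop \<in> modal_terms L"
  "TJoin s t \<in> modal_terms L \<longleftrightarrow> s \<in> modal_terms L \<and> t \<in> modal_terms L"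
  "TMeet s t \<in> modal_terms L \<longleftrightarrow> s \<in> modal_terms L \<and> t \<in> modal_terms L"
  by (auto simp: modal_terms_def)

text \<open>Symmetry and transitivity are left out: as rewrite rules, one would reverse its goal
  forever and the other would need a guessed intermediate term.\<close>

lemmas modal_cong_axioms = modal_cong.refl modal_cong.join_cong modal_cong.meet_cong
  modal_cong.join_assoc modal_cong.meet_assoc modal_cong.join_comm modal_cong.meet_comm
  modal_cong.join_absorb modal_cong.meet_absorb modal_cong.distrib modal_cong.join_bot
  modal_cong.meet_top modal_cong.dia_bot modal_cong.dia_join modal_cong.box_top modal_cong.box_meet
  modal_cong.box_join_le modal_cong.box_dia_le

context DL_object
begin

lemma modal_cong_terms: "(s, t) \<in> modal_cong L \<Longrightarrow> s \<in> modal_terms L \<and> t \<in> modal_terms L"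
  by (induction rule: modal_cong.induct) auto

lemma equiv_modal_cong: "equiv (modal_terms L) (modal_cong L)"
proof (rule equivI)
  show "modal_cong L \<subseteq> modal_terms L \<times> modal_terms L" using modal_cong_terms by auto
  show "refl_on (modal_terms L) (modal_cong L)" by (auto simp: refl_on_def intro: modal_cong.refl)
  show "Relation.sym (modal_cong L)" by (rule symI) (rule modal_cong.sym)
  show "Relation.trans (modal_cong L)" by (rule transI) (rule modal_cong.trans)
qed

lemma modal_class_eq_iff:
  "\<lbrakk>s \<in> modal_terms L; t \<in> modal_terms L\<rbrakk> \<Longrightarrow> modal_class L s = modal_class L t \<longleftrightarrow> (s, t) \<in> modal_cong L"
  unfolding modal_class_def by (rule eq_equiv_class_iff[OF equiv_modal_cong])

lemma modal_class_eqI: "(s, t) \<in> modal_cong L \<Longrightarrow> modal_class L s = modal_class L t"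
  using modal_class_eq_iff modal_cong_terms by blast

lemma modal_class_self: "t \<in> modal_terms L \<Longrightarrow> t \<in> modal_class L t"
  by (simp add: modal_class_def modal_cong.refl)

lemma K_carrier: "carrier (K_obj L) = modal_class L ` modal_terms L"
  by (auto simp: K_obj_def quotient_def modal_class_def)

lemma K_le:
  assumes "s \<in> modal_terms L" "t \<in> modal_terms L"
  shows "modal_class L s \<sqsubseteq>\<^bsub>K_obj L\<^esub> modal_class L t \<longleftrightarrow> modal_class L (TJoin s t) = modal_class L t"
proof
  assume "modal_class L s \<sqsubseteq>\<^bsub>K_obj L\<^esub> modal_class L t"
  then obtain s' t' where st: "(s, s') \<in> modal_cong L" "(t, t') \<in> modal_cong L" "(TJoin s' t', t') \<in> modal_cong L"
    by (auto simp: K_obj_def modal_class_def)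
  from st have "(TJoin s t, t) \<in> modal_cong L"
    by (meson modal_cong.join_cong modal_cong.sym modal_cong.trans)
  then show "modal_class L (TJoin s t) = modal_class L t" by (rule modal_class_eqI)
next
  assume "modal_class L (TJoin s t) = modal_class L t"
  then have "(TJoin s t, t) \<in> modal_cong L" using assms by (simp add: modal_class_eq_iff)
  then show "modal_class L s \<sqsubseteq>\<^bsub>K_obj L\<^esub> modal_class L t"
    using modal_class_self assms by (auto simp: K_obj_def)
qed

lemma K_lattice:
  shows K_DL: "DL_object (K_obj L)"
    and K_join: "\<lbrakk>s \<in> modal_terms L; t \<in> modal_terms L\<rbrakk>
      \<Longrightarrow> modal_class L s \<squnion>\<^bsub>K_obj L\<^esub> modal_class L t = modal_class L (TJoin s t)"
    and K_meet: "\<lbrakk>s \<in> modal_terms L; t \<in> modal_terms L\<rbrakk>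
      \<Longrightarrow> modal_class L s \<sqinter>\<^bsub>K_obj L\<^esub> modal_class L t = modal_class L (TMeet s t)"
    and K_bottom: "\<bottom>\<^bsub>K_obj L\<^esub> = modal_class L TBot" and K_top: "\<top>\<^bsub>K_obj L\<^esub> = modal_class L TTop"
proof -
  let ?c = "modal_class L" and ?T = "modal_terms L"
  \<comment> \<open>Any choice of representatives will do; \<open>j\<close> and \<open>m\<close>
    below do not depend on it, by the congruence rules.\<close>
  define rep where "rep A = (SOME t. t \<in> ?T \<and> ?c t = A)" for A
  have rep: "rep (?c t) \<in> ?T" "?c (rep (?c t)) = ?c t" if "t \<in> ?T" for t
    using someI[of "\<lambda>s. s \<in> ?T \<and> ?c s = ?c t" t] that by (simp_all add: rep_def)
  define j where "j A B = ?c (TJoin (rep A) (rep B))" for A B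
  define m where "m A B = ?c (TMeet (rep A) (rep B))" for A B
  have j: "j (?c s) (?c t) = ?c (TJoin s t)" if "s \<in> ?T" "t \<in> ?T" for s t
    using rep[OF that(1)] rep[OF that(2)] that
    by (simp add: j_def modal_class_eq_iff modal_cong.join_cong)
  have m: "m (?c s) (?c t) = ?c (TMeet s t)" if "s \<in> ?T" "t \<in> ?T" for s t
    using rep[OF that(1)] rep[OF that(2)] that
    by (simp add: m_def modal_class_eq_iff modal_cong.meet_cong)
  have eq: "(.=\<^bsub>K_obj L\<^esub>) = (=)" by (simp add: K_obj_def)
  have I: "bounded_distributive_lattice (K_obj L) \<and>
    (\<forall>x\<in>carrier (K_obj L). \<forall>y\<in>carrier (K_obj L). x \<squnion>\<^bsub>K_obj L\<^esub> y = j x y) \<and>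
    (\<forall>x\<in>carrier (K_obj L). \<forall>y\<in>carrier (K_obj L). x \<sqinter>\<^bsub>K_obj L\<^esub> y = m x y) \<and>
    \<bottom>\<^bsub>K_obj L\<^esub> = ?c TBot \<and> \<top>\<^bsub>K_obj L\<^esub> = ?c TTop"
    by (intro conjI ballI bounded_distributive_lattice_equationalI[where j = j and m = m
            and b = "?c TBot" and t = "?c TTop"]; (unfold K_carrier)?; (elim imageE)?;
        simp add: K_le j m eq modal_class_eq_iff modal_cong_axioms imageI)
  then show "DL_object (K_obj L)" "\<bottom>\<^bsub>K_obj L\<^esub> = ?c TBot" "\<top>\<^bsub>K_obj L\<^esub> = ?c TTop"
    by (simp_all add: DL_object_def)
  show "?c s \<squnion>\<^bsub>K_obj L\<^esub> ?c t = ?c (TJoin s t)" "?c s \<sqinter>\<^bsub>K_obj L\<^esub> ?c t = ?c (TMeet s t)"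
    if "s \<in> ?T" "t \<in> ?T" for s t
    using I j[OF that] m[OF that] that by (simp_all add: K_carrier)
qed

end

section \<open>Functoriality of the modal lattice\<close>

lemma modal_terms_map:
  "\<lbrakk>f \<in> DL_hom L M; t \<in> modal_terms L\<rbrakk> \<Longrightarrow> map_modal_term f t \<in> modal_terms M"
  using DL_homD(2)[of f L M] by (auto simp: modal_terms_def modal_term.set_map)

text \<open>By induction on the derivation of the congruence: since \<open>f\<close> is a
  homomorphism, each defining relation over \<open>L\<close> becomes an instance of the same
  relation over \<open>M\<close>.\<close>

lemma modal_cong_map:
  assumes "DL_object L" "DL_object M" and f: "f \<in> DL_hom L M" and st: "(s, t) \<in> modal_cong L"
  shows "(map_modal_term f s, map_modal_term f t) \<in> modal_cong M"
proof -
  interpret L: DL_object L by fact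
  interpret M: DL_object M by fact
  note hom = DL_homD(2-)[OF f]
  show ?thesis
    using st
  proof (induction rule: modal_cong.induct)
    case (sym s t) then show ?case by (simp add: modal_cong.sym)
  next
    case (trans s t u) then show ?case using modal_cong.trans by blast
  qed (simp_all add: hom modal_terms_map[OF f] modal_cong_axioms)
qed

context
  fixes L :: "'a gorder" and M :: "'b gorder" and f
  assumes L: "DL_object L" and M: "DL_object M" and f: "f \<in> DL_hom L M"
begin

interpretation L: DL_object L by (rule L)
interpretation M: DL_object M by (rule M)

text \<open>The classwise definition agrees with mapping one representative: congruent terms have
  congruent images, and the relational image fills up the whole target class.\<close>

lemma K_map_class:
  assumes "t \<in> modal_terms L"
  shows "K_map L M f (modal_class L t) = modal_class M (map_modal_term f t)"
proof -
  have "modal_cong M `` (map_modal_term f ` modal_class L t) = modal_class M (map_modal_term f t)"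
  proof (intro equalityI subsetI)
    fix u assume "u \<in> modal_cong M `` (map_modal_term f ` modal_class L t)"
    then obtain s where s: "(t, s) \<in> modal_cong L" "(map_modal_term f s, u) \<in> modal_cong M"
      by (auto simp: modal_class_def)
    show "u \<in> modal_class M (map_modal_term f t)"
      using modal_cong.trans[OF modal_cong_map[OF L M f s(1)] s(2)] by (simp add: modal_class_def)
  next
    fix u assume "u \<in> modal_class M (map_modal_term f t)"
    then show "u \<in> modal_cong M `` (map_modal_term f ` modal_class L t)"
      using L.modal_class_self[OF assms] by (auto simp: modal_class_def)
  qed
  then show ?thesis using assms by (simp add: K_map_def L.K_carrier)
qed

lemma K_map_hom: "K_map L M f \<in> DL_hom (K_obj L) (K_obj M)"
proof (rule DL_homI[OF L.K_DL M.K_DL])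
  show "K_map L M f \<in> carrier (K_obj L) \<rightarrow>\<^sub>E carrier (K_obj M)"
  proof (rule PiE_I)
    fix A assume "A \<in> carrier (K_obj L)"
    then show "K_map L M f A \<in> carrier (K_obj M)"
      using modal_terms_map[OF f] by (auto simp: L.K_carrier M.K_carrier K_map_class)
  qed (simp add: K_map_def)
next
  fix A B assume "A \<in> carrier (K_obj L)" "B \<in> carrier (K_obj L)"
  then obtain s t where "s \<in> modal_terms L" "t \<in> modal_terms L" "A = modal_class L s" "B = modal_class L t"
    by (auto simp: L.K_carrier)
  then show "K_map L M f (A \<squnion>\<^bsub>K_obj L\<^esub> B) = K_map L M f A \<squnion>\<^bsub>K_obj M\<^esub> K_map L M f B"
    "K_map L M f (A \<sqinter>\<^bsub>K_obj L\<^esub> B) = K_map L M f A \<sqinter>\<^bsub>K_obj M\<^esub> K_map L M f B"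
    by (simp_all add: L.K_join L.K_meet M.K_join M.K_meet K_map_class modal_terms_map[OF f])
next
  show "K_map L M f \<bottom>\<^bsub>K_obj L\<^esub> = \<bottom>\<^bsub>K_obj M\<^esub>" "K_map L M f \<top>\<^bsub>K_obj L\<^esub> = \<top>\<^bsub>K_obj M\<^esub>"
    by (simp_all add: L.K_bottom M.K_bottom L.K_top M.K_top K_map_class)
qed

end

lemma DL_hom_id: "DL_object L \<Longrightarrow> restrict id (carrier L) \<in> DL_hom L L"
proof -
  assume "DL_object L"
  then interpret DL_object L .
  show ?thesis by (rule DL_homI) (use DL_object_axioms in auto)
qed

lemma DL_hom_compose:
  assumes "DL_object L" "DL_object M" "DL_object N" "f \<in> DL_hom L M" "g \<in> DL_hom M N"
  shows "compose (carrier L) g f \<in> DL_hom L N"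
proof -
  interpret L: DL_object L by fact
  show ?thesis
    using DL_homD(2-)[OF assms(4)] DL_homD(2-)[OF assms(5)]
    by (intro DL_homI[OF assms(1,3)]) (simp_all add: compose_def)
qed

lemma K_map_id:
  assumes "DL_object L"
  shows "K_map L L (restrict id (carrier L)) = restrict id (carrier (K_obj L))"
proof
  interpret L: DL_object L by fact
  fix A
  show "K_map L L (restrict id (carrier L)) A = restrict id (carrier (K_obj L)) A"
  proof (cases "A \<in> carrier (K_obj L)")
    case True
    then obtain t where t: "t \<in> modal_terms L" "A = modal_class L t" by (auto simp: L.K_carrier)
    have "map_modal_term (restrict id (carrier L)) t = map_modal_term id t"
      using t(1) by (intro modal_term.map_cong) (auto simp: modal_terms_def)
    then show ?thesis
      using t True K_map_class[OF assms assms DL_hom_id[OF assms]] by (simp add: modal_term.map_id)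
  qed (simp add: K_map_def)
qed

lemma K_map_compose:
  assumes "DL_object L" "DL_object M" "DL_object N" and f: "f \<in> DL_hom L M" and g: "g \<in> DL_hom M N"
  shows "K_map L N (compose (carrier L) g f) = compose (carrier (K_obj L)) (K_map M N g) (K_map L M f)"
proof
  interpret L: DL_object L by fact
  fix A
  show "K_map L N (compose (carrier L) g f) A = compose (carrier (K_obj L)) (K_map M N g) (K_map L M f) A"
  proof (cases "A \<in> carrier (K_obj L)")
    case True
    then obtain t where t: "t \<in> modal_terms L" "A = modal_class L t" by (auto simp: L.K_carrier)
    have "map_modal_term (compose (carrier L) g f) t = map_modal_term (g \<circ> f) t"
      using t(1) by (intro modal_term.map_cong) (auto simp: modal_terms_def compose_def)
    then show ?thesis
      using t True K_map_class[OF assms(1,3) DL_hom_compose[OF assms]] K_map_class[OF assms(1,2) f]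
        K_map_class[OF assms(2,3) g] modal_terms_map[OF f]
      by (simp add: compose_def modal_term.map_comp)
  qed (simp add: K_map_def compose_def)
qed

section \<open>Representing prime filters by closed convex sets\<close>

text \<open>A term is evaluated at a whole set \<open>C\<close> of points, regarded as one point of
  the hyperspace; \<open>V\<close> interprets the elements of the lattice as sets of points.\<close>

primrec sat :: "('a \<Rightarrow> 'p set) \<Rightarrow> 'p set \<Rightarrow> 'a modal_term \<Rightarrow> bool" where
  "sat V C (Dia a) \<longleftrightarrow> C \<inter> V a \<noteq> {}"
| "sat V C (Box a) \<longleftrightarrow> C \<subseteq> V a"
| "sat V C TBot \<longleftrightarrow> False"
| "sat V C TTop \<longleftrightarrow> True"
| "sat V C (TJoin s t) \<longleftrightarrow> sat V C s \<or> sat V C t"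
| "sat V C (TMeet s t) \<longleftrightarrow> sat V C s \<and> sat V C t"

text \<open>The assumptions make \<open>V\<close> an isomorphism of \<open>L\<close> onto the clopen
  upsets of \<open>X\<close>. Keeping \<open>V\<close> explicit treats an abstract lattice and a
  lattice of clopen upsets alike, with no transport along the duality.\<close>

locale DL_representation = L: DL_object L + X: priestley X
  for L :: "'a gorder" and X :: "'p ordered_space" +
  fixes V :: "'a \<Rightarrow> 'p set"
  assumes V_up: "a \<in> carrier L \<Longrightarrow> V a \<in> clopen_upsets X"
    and V_onto: "U \<in> clopen_upsets X \<Longrightarrow> \<exists>a\<in>carrier L. U = V a"
    and V_join: "\<lbrakk>a \<in> carrier L; b \<in> carrier L\<rbrakk> \<Longrightarrow> V (a \<squnion>\<^bsub>L\<^esub> b) = V a \<union> V b"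
    and V_meet: "\<lbrakk>a \<in> carrier L; b \<in> carrier L\<rbrakk> \<Longrightarrow> V (a \<sqinter>\<^bsub>L\<^esub> b) = V a \<inter> V b"
    and V_bottom: "V \<bottom>\<^bsub>L\<^esub> = {}" and V_top: "V \<top>\<^bsub>L\<^esub> = points X"
    and V_le: "\<lbrakk>a \<in> carrier L; b \<in> carrier L; V a \<subseteq> V b\<rbrakk> \<Longrightarrow> a \<sqsubseteq>\<^bsub>L\<^esub> b"
begin

sublocale K: DL_object "K_obj L" by (rule L.K_DL)

text \<open>Soundness. The mixed relations are plain set theory: a set inside a union
  \<open>A \<union> B\<close> is inside \<open>A\<close> or meets \<open>B\<close>, and a set inside
  \<open>A\<close> that meets \<open>B\<close> meets \<open>A \<inter> B\<close>.\<close>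

lemma sat_cong:
  assumes "(s, t) \<in> modal_cong L" and C: "C \<subseteq> points X"
  shows "sat V C s \<longleftrightarrow> sat V C t"
  using assms(1)
proof (induction rule: modal_cong.induct)
  case (box_join_le a b)
  then show ?case by (auto simp: V_join)
next
  case (box_dia_le a b)
  then show ?case by (auto simp: V_meet)
qed (auto simp: V_join V_meet V_bottom V_top C)

definition Th :: "'p set \<Rightarrow> 'a modal_term set set" where
  "Th C = {modal_class L t |t. t \<in> modal_terms L \<and> sat V C t}"

lemma Th_iff:
  assumes "C \<subseteq> points X" "t \<in> modal_terms L"
  shows "modal_class L t \<in> Th C \<longleftrightarrow> sat V C t"
proof
  assume "modal_class L t \<in> Th C"
  then obtain s where s: "s \<in> modal_terms L" "sat V C s" "modal_class L t = modal_class L s"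
    by (auto simp: Th_def)
  then have "(t, s) \<in> modal_cong L" using assms(2) by (simp add: L.modal_class_eq_iff)
  then show "sat V C t" using sat_cong[OF _ assms(1)] s(2) by blast
qed (use assms in \<open>auto simp: Th_def\<close>)

lemma Th_subset: "Th C \<subseteq> carrier (K_obj L)"
  by (auto simp: Th_def L.K_carrier)

text \<open>Truth at a fixed \<open>C\<close> is two-valued and commutes with joins and meets, and
  by soundness it depends only on the class of the term.\<close>

lemma prime_filter_Th:
  assumes C: "C \<subseteq> points X"
  shows "prime_filter (K_obj L) (Th C)"
  unfolding prime_filter_def
proof (intro conjI ballI impI)
  show "Th C \<subseteq> carrier (K_obj L)" by (rule Th_subset)
  have "modal_class L TBot \<notin> Th C" using Th_iff[OF C, of TBot] by simp
  moreover have "modal_class L TBot \<in> carrier (K_obj L)" by (simp add: L.K_carrier)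
  ultimately show "Th C \<noteq> carrier (K_obj L)" by metis
  show "\<top>\<^bsub>K_obj L\<^esub> \<in> Th C" using Th_iff[OF C, of TTop] by (simp add: L.K_top)
next
  fix A B assume "A \<in> Th C" "B \<in> carrier (K_obj L)" and le: "A \<sqsubseteq>\<^bsub>K_obj L\<^esub> B"
  then obtain s t where st: "s \<in> modal_terms L" "sat V C s" "A = modal_class L s"
    "t \<in> modal_terms L" "B = modal_class L t"
    by (auto simp: Th_def L.K_carrier)
  then have "(TJoin s t, t) \<in> modal_cong L"
    using le by (simp add: L.K_le L.modal_class_eq_iff)
  from sat_cong[OF this C] st show "B \<in> Th C" by (simp add: Th_iff[OF C])
next
  fix A B assume "A \<in> Th C" "B \<in> Th C"
  then obtain s t where "s \<in> modal_terms L" "sat V C s" "A = modal_class L s"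
    "t \<in> modal_terms L" "B = modal_class L t" "sat V C t"
    by (auto simp: Th_def)
  then show "A \<sqinter>\<^bsub>K_obj L\<^esub> B \<in> Th C" by (simp add: L.K_meet Th_iff[OF C])
next
  fix A B assume "A \<in> carrier (K_obj L)" "B \<in> carrier (K_obj L)" and "A \<squnion>\<^bsub>K_obj L\<^esub> B \<in> Th C"
  moreover from this obtain s t where "s \<in> modal_terms L" "A = modal_class L s"
    "t \<in> modal_terms L" "B = modal_class L t"
    by (auto simp: L.K_carrier)
  ultimately show "A \<in> Th C \<or> B \<in> Th C" by (simp add: L.K_join Th_iff[OF C])
qed

text \<open>Terms contain no negation, so inclusion of theories is decided by the generators Dia and
  Box; these express exactly the tests of \<open>C_ord_iff\<close>, because every clopen upset is
  some \<open>V a\<close>.\<close>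

lemma Th_mono_iff:
  assumes C: "C \<in> convex_closed_sets X" and D: "D \<in> convex_closed_sets X"
  shows "Th C \<subseteq> Th D \<longleftrightarrow> (C, D) \<in> ord (C_obj X)"
proof
  note CD = X.convex_closed_points[OF C] X.convex_closed_points[OF D]
  show "(C, D) \<in> ord (C_obj X)" if "Th C \<subseteq> Th D"
    unfolding X.C_ord_iff[OF C D]
  proof
    fix U assume "U \<in> clopen_upsets X"
    then obtain a where a: "a \<in> carrier L" "U = V a" using V_onto by blast
    have "sat V C t \<longrightarrow> sat V D t" if "t \<in> modal_terms L" for t
      using \<open>Th C \<subseteq> Th D\<close> Th_iff[OF CD(1) that] Th_iff[OF CD(2) that] by blast
    from this[of "Dia a"] this[of "Box a"]
    show "(C \<inter> U \<noteq> {} \<longrightarrow> D \<inter> U \<noteq> {}) \<and> (C \<subseteq> U \<longrightarrow> D \<subseteq> U)" using a by simp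
  qed
  assume ord: "(C, D) \<in> ord (C_obj X)"
  have "sat V C t \<longrightarrow> sat V D t" if "t \<in> modal_terms L" for t
    using that
  proof (induction t)
    case (Dia a)
    then show ?case using ord V_up[of a] unfolding X.C_ord_iff[OF C D] by simp
  next
    case (Box a)
    then show ?case using ord V_up[of a] unfolding X.C_ord_iff[OF C D] by simp
  qed auto
  then show "Th C \<subseteq> Th D" by (auto simp: Th_def)
qed

text \<open>The largest candidate: a set with theory \<open>x\<close> must lie in \<open>V a\<close>
  when \<open>Box a\<close> is in \<open>x\<close>, and must miss \<open>V a\<close> when
  \<open>Dia a\<close> is not in \<open>x\<close>. All points permitted by these constraints are
  kept.\<close>

definition Pts :: "'a modal_term set set \<Rightarrow> 'p set" where
  "Pts x = {p \<in> points X. \<forall>a\<in>carrier L. (modal_class L (Box a) \<in> x \<longrightarrow> p \<in> V a) \<and>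
     (p \<in> V a \<longrightarrow> modal_class L (Dia a) \<in> x)}"

text \<open>Each constraint cuts out a clopen upset or the complement of one. For convexity, the Box
  constraints are inherited from the point below and the Dia constraints from the point
  above.\<close>

lemma Pts_convex_closed: "Pts x \<in> convex_closed_sets X"
proof -
  have cl: "closedin (topo X) {p \<in> points X. (modal_class L (Box a) \<in> x \<longrightarrow> p \<in> V a) \<and>
     (p \<in> V a \<longrightarrow> modal_class L (Dia a) \<in> x)}" (is "closedin _ (?S a)") if "a \<in> carrier L" for a
  proof -
    note V = X.clopen_upsetD[OF V_up[OF that]]
    have "closedin (topo X) (points X - V a)" using V by (simp add: closedin_def double_diff)
    moreover have "?S a = (if modal_class L (Box a) \<in> x then V a else points X) \<inter>
        (if modal_class L (Dia a) \<in> x then points X else points X - V a)"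
      using V(3) by auto
    ultimately show ?thesis using V(2) by (auto intro: closedin_Int)
  qed
  have "Pts x = points X \<inter> \<Inter>(?S ` carrier L)" by (auto simp: Pts_def)
  moreover have "\<dots> = \<Inter>(?S ` carrier L)" using L.top_closed by blast
  moreover have "closedin (topo X) (\<Inter>(?S ` carrier L))"
    using cl L.top_closed by (intro closedin_Inter) auto
  ultimately have closed: "closedin (topo X) (Pts x)" by simp
  show ?thesis
    unfolding convex_closed_sets_def
  proof (intro CollectI conjI ballI allI impI closed)
    fix p q z assume pq: "p \<in> Pts x" "q \<in> Pts x" and "(p, z) \<in> ord X \<and> (z, q) \<in> ord X"
    then have z: "(p, z) \<in> ord X" "(z, q) \<in> ord X" by simp_all
    have "z \<in> V a" if "a \<in> carrier L" "p \<in> V a" for a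
      using X.clopen_upsetD(4)[OF V_up[OF that(1)] that(2) z(1)] .
    moreover have "q \<in> V a" if "a \<in> carrier L" "z \<in> V a" for a
      using X.clopen_upsetD(4)[OF V_up[OF that(1)] that(2) z(2)] .
    ultimately show "z \<in> Pts x" using pq X.ord_points[OF z(1)] by (simp add: Pts_def)
  qed
qed

text \<open>Compactness turns an empty intersection into a single inequality in \<open>L\<close>, to which the
  two mixed relations between \<open>\<box>\<close> and \<open>\<diamond>\<close> apply.\<close>

lemma Pts_disjoint:
  assumes x: "prime_filter (K_obj L) x" and W: "closedin (topo X) W" and disj: "Pts x \<inter> W = {}"
  obtains b c where "b \<in> carrier L" "c \<in> carrier L"
    "modal_class L (Box b) \<in> x" "modal_class L (Dia c) \<notin> x" "V b \<inter> W \<subseteq> V c"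
proof -
  \<comment> \<open>A pair holds one Box constraint and one Dia constraint, and \<open>?S\<close> is
    the part of \<open>W\<close> obeying both; the intersection of all these parts is
    \<open>Pts x \<inter> W\<close>.\<close>
  define G where "G = {(b, c). b \<in> carrier L \<and> c \<in> carrier L \<and>
    modal_class L (Box b) \<in> x \<and> modal_class L (Dia c) \<notin> x}"
  let ?S = "\<lambda>(b, c). (V b \<inter> W) - V c"
  have box: "modal_class L (Box (a \<sqinter>\<^bsub>L\<^esub> b)) = modal_class L (Box a) \<sqinter>\<^bsub>K_obj L\<^esub> modal_class L (Box b)"
    and dia: "modal_class L (Dia (a \<squnion>\<^bsub>L\<^esub> b)) = modal_class L (Dia a) \<squnion>\<^bsub>K_obj L\<^esub> modal_class L (Dia b)"
    if "a \<in> carrier L" "b \<in> carrier L" for a b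
    using that L.modal_class_eqI[OF modal_cong.box_meet[OF that]]
      L.modal_class_eqI[OF modal_cong.dia_join[OF that]] by (simp_all add: L.K_meet L.K_join)
  \<comment> \<open>The family is directed downwards, since Box turns meets into meets, Dia turns
    joins into joins, and \<open>x\<close> is prime. Therefore compactness yields one empty member
    instead of a finite subfamily with empty intersection.\<close>
  have G_Int: "\<exists>k\<in>G. ?S k \<subseteq> ?S i \<inter> ?S j" if "i \<in> G" "j \<in> G" for i j
  proof -
    obtain b c b' c' where ij: "i = (b, c)" "j = (b', c')" by (cases i, cases j)
    with that have "(b \<sqinter>\<^bsub>L\<^esub> b', c \<squnion>\<^bsub>L\<^esub> c') \<in> G"
      using K.prime_filter_meet_iff[OF x] K.prime_filter_join_iff[OF x]
      by (simp add: G_def box dia L.K_carrier)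
    moreover have "?S (b \<sqinter>\<^bsub>L\<^esub> b', c \<squnion>\<^bsub>L\<^esub> c') \<subseteq> ?S i \<inter> ?S j"
      using that ij by (auto simp: G_def V_meet V_join)
    ultimately show ?thesis by blast
  qed
  have top: "(\<top>\<^bsub>L\<^esub>, \<bottom>\<^bsub>L\<^esub>) \<in> G"
    using K.prime_filter_top[OF x] K.prime_filter_bottom[OF x]
      L.modal_class_eqI[OF modal_cong.box_top] L.modal_class_eqI[OF modal_cong.dia_bot]
    by (simp add: G_def L.K_top L.K_bottom)
  have "\<exists>k\<in>G. ?S k = {}"
  proof (rule ccontr)
    assume ne: "\<not> (\<exists>k\<in>G. ?S k = {})"
    have cl: "closedin (topo X) (?S k)" if "k \<in> G" for k
      using that W X.clopen_upsetD(1,2)[OF V_up] by (auto simp: G_def intro!: closedin_diff closedin_Int)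
    have "\<exists>k\<in>G. ?S k \<subseteq> \<Inter>\<F>" if "finite \<F>" "\<F> \<subseteq> ?S ` G" for \<F>
      using that
    proof (induction \<F>)
      case empty then show ?case using top by auto
    next
      case (insert A \<F>)
      then obtain i j where "i \<in> G" "j \<in> G" "?S i \<subseteq> \<Inter>\<F>" "A = ?S j" by auto
      with G_Int[of i j] show ?case by auto
    qed
    then have "\<forall>\<F>. finite \<F> \<and> \<F> \<subseteq> ?S ` G \<longrightarrow> \<Inter>\<F> \<noteq> {}" using ne by fastforce
    moreover have "\<forall>A\<in>?S ` G. closedin (topo X) A" using cl by blast
    ultimately have "\<Inter>(?S ` G) \<noteq> {}" using X.compact unfolding compact_space_fip by blast
    then obtain p where p: "\<And>b c. (b, c) \<in> G \<Longrightarrow> p \<in> V b \<inter> W - V c" by force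
    have pW: "p \<in> W" "p \<in> points X" using p[OF top] by (auto simp: V_top)
    \<comment> \<open>Pairing \<open>a\<close> with the bottom element isolates its Box constraint,
      pairing it with the top element its Dia constraint.\<close>
    have "(modal_class L (Box a) \<in> x \<longrightarrow> p \<in> V a) \<and> (p \<in> V a \<longrightarrow> modal_class L (Dia a) \<in> x)"
      if "a \<in> carrier L" for a
      using p[of a "\<bottom>\<^bsub>L\<^esub>"] p[of "\<top>\<^bsub>L\<^esub>" a] top that by (auto simp: G_def)
    then have "p \<in> Pts x" using pW by (simp add: Pts_def)
    then show False using disj pW by blast
  qed
  then show thesis using that by (force simp: G_def)
qed

text \<open>If \<open>Pts x\<close> missed \<open>V a\<close>, then \<open>b \<sqinter> a\<close>
  would lie below \<open>c\<close> for some \<open>Box b\<close> in \<open>x\<close> and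
  \<open>Dia c\<close> outside \<open>x\<close>. The relation \<open>box_dia_le\<close> and
  monotonicity of Dia, which is a case of \<open>dia_join\<close>, put
  \<open>Dia (b \<sqinter> a)\<close> and then \<open>Dia c\<close> into \<open>x\<close>, a
  contradiction.\<close>

lemma Dia_mem_iff:
  assumes x: "prime_filter (K_obj L) x" and a: "a \<in> carrier L"
  shows "modal_class L (Dia a) \<in> x \<longleftrightarrow> Pts x \<inter> V a \<noteq> {}"
proof
  show "modal_class L (Dia a) \<in> x" if "Pts x \<inter> V a \<noteq> {}" using that a by (auto simp: Pts_def)
  assume dia: "modal_class L (Dia a) \<in> x"
  show "Pts x \<inter> V a \<noteq> {}"
  proof
    assume "Pts x \<inter> V a = {}"
    then obtain b c where bc: "b \<in> carrier L" "c \<in> carrier L" "modal_class L (Box b) \<in> x"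
      "modal_class L (Dia c) \<notin> x" "V b \<inter> V a \<subseteq> V c"
      by (rule Pts_disjoint[OF x X.clopen_upsetD(2)[OF V_up[OF a]]])
    let ?m = "b \<sqinter>\<^bsub>L\<^esub> a"
    have m: "?m \<in> carrier L" "?m \<sqsubseteq>\<^bsub>L\<^esub> c" using bc a V_le[of ?m c] by (simp_all add: V_meet)
    have "TMeet (Box b) (Dia a) \<in> modal_terms L" using bc a by simp
    moreover have "modal_class L (TMeet (Box b) (Dia a)) \<sqsubseteq>\<^bsub>K_obj L\<^esub> modal_class L (Dia ?m)"
      using bc a m L.modal_class_eqI[OF modal_cong.box_dia_le[OF bc(1) a]] by (simp add: L.K_le)
    moreover have "modal_class L (TMeet (Box b) (Dia a)) \<in> x"
      using K.prime_filter_meet_iff[OF x] bc a dia by (simp add: L.K_carrier flip: L.K_meet)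
    ultimately have "modal_class L (Dia ?m) \<in> x"
      using prime_filter_up[OF x] m by (auto simp: L.K_carrier)
    moreover have "modal_class L (Dia ?m) \<sqsubseteq>\<^bsub>K_obj L\<^esub> modal_class L (Dia c)"
      using bc m L.le_iff_meet[of ?m c] L.modal_class_eqI[OF modal_cong.dia_join[OF m(1) bc(2)]]
      by (simp add: L.K_le)
    ultimately show False
      using prime_filter_up[OF x] bc by (auto simp: L.K_carrier)
  qed
qed

text \<open>Taking for \<open>W\<close> the complement of \<open>V a\<close> gives \<open>b\<close>
  below \<open>a \<squnion> c\<close>, with \<open>Box b\<close> in \<open>x\<close> and
  \<open>Dia c\<close> outside. Then \<open>Box (a \<squnion> c)\<close> is in \<open>x\<close>,
  \<open>box_join_le\<close> puts the join of \<open>Box a\<close> and \<open>Dia c\<close> into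
  \<open>x\<close>, and primeness leaves \<open>Box a\<close>.\<close>

lemma Box_mem_iff:
  assumes x: "prime_filter (K_obj L) x" and a: "a \<in> carrier L"
  shows "modal_class L (Box a) \<in> x \<longleftrightarrow> Pts x \<subseteq> V a"
proof
  show "Pts x \<subseteq> V a" if "modal_class L (Box a) \<in> x" using that a by (auto simp: Pts_def)
  assume sub: "Pts x \<subseteq> V a"
  then have "Pts x \<inter> (points X - V a) = {}" by blast
  moreover have "closedin (topo X) (points X - V a)"
    using X.clopen_upsetD(1)[OF V_up[OF a]] by (simp add: closedin_diff)
  ultimately obtain b c where bc: "b \<in> carrier L" "c \<in> carrier L" "modal_class L (Box b) \<in> x"
    "modal_class L (Dia c) \<notin> x" "V b \<inter> (points X - V a) \<subseteq> V c"
    using Pts_disjoint[OF x] by metis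
  let ?j = "a \<squnion>\<^bsub>L\<^esub> c"
  have "V b \<subseteq> V ?j" using bc a X.clopen_upsetD(3)[OF V_up[OF bc(1)]] by (auto simp: V_join)
  then have j: "?j \<in> carrier L" "b \<sqsubseteq>\<^bsub>L\<^esub> ?j" using bc a V_le[of b ?j] by simp_all
  \<comment> \<open>Monotonicity of Box is extracted from \<open>box_meet\<close>: the class of
    \<open>Box b\<close> is its own meet with that of \<open>Box ?j\<close>.\<close>
  have "b = b \<sqinter>\<^bsub>L\<^esub> ?j" using bc j L.le_iff_join[of b ?j] by simp
  then have "modal_class L (Box b) = modal_class L (Box b) \<sqinter>\<^bsub>K_obj L\<^esub> modal_class L (Box ?j)"
    using bc j L.modal_class_eqI[OF modal_cong.box_meet[OF bc(1) j(1)]] by (simp add: L.K_meet)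
  then have "modal_class L (Box ?j) \<in> x"
    using bc j K.prime_filter_meet_iff[OF x, of "modal_class L (Box b)" "modal_class L (Box ?j)"]
    by (simp add: L.K_carrier)
  moreover have "modal_class L (Box ?j) \<sqsubseteq>\<^bsub>K_obj L\<^esub> modal_class L (TJoin (Box a) (Dia c))"
    using bc a j L.modal_class_eqI[OF modal_cong.box_join_le[OF a bc(2)]] by (simp add: L.K_le)
  ultimately have "modal_class L (TJoin (Box a) (Dia c)) \<in> x"
    using prime_filter_up[OF x] bc a by (auto simp: L.K_carrier)
  then show "modal_class L (Box a) \<in> x"
    using K.prime_filter_join_iff[OF x, of "modal_class L (Box a)" "modal_class L (Dia c)"] bc a
    by (simp add: L.K_carrier L.K_join)
qed

text \<open>Truth lemma: the generators are the two preceding equivalences, and the lattice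
  operations follow from primeness of \<open>x\<close>.\<close>

lemma sat_Pts:
  assumes x: "prime_filter (K_obj L) x" and "t \<in> modal_terms L"
  shows "sat V (Pts x) t \<longleftrightarrow> modal_class L t \<in> x"
  using assms(2)
proof (induction t)
  case TBot
  then show ?case using K.prime_filter_bottom[OF x] by (simp add: L.K_bottom)
next
  case TTop
  then show ?case using K.prime_filter_top[OF x] by (simp add: L.K_top)
next
  case (TJoin s t)
  then show ?case
    using K.prime_filter_join_iff[OF x, of "modal_class L s" "modal_class L t"]
    by (simp add: L.K_carrier L.K_join)
next
  case (TMeet s t)
  then show ?case
    using K.prime_filter_meet_iff[OF x, of "modal_class L s" "modal_class L t"]
    by (simp add: L.K_carrier L.K_meet)
qed (simp_all add: Dia_mem_iff[OF x] Box_mem_iff[OF x])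

lemma Th_Pts:
  assumes x: "prime_filter (K_obj L) x"
  shows "Th (Pts x) = x"
  using prime_filter_subset[OF x] sat_Pts[OF x] by (auto simp: Th_def L.K_carrier)

text \<open>Both sets are closed and convex and have the same theory, so each is below the other in
  the Egli-Milner order.\<close>

lemma Pts_Th:
  assumes C: "C \<in> convex_closed_sets X"
  shows "Pts (Th C) = C"
proof -
  have "Th (Pts (Th C)) = Th C"
    by (rule Th_Pts[OF prime_filter_Th[OF X.convex_closed_points[OF C]]])
  then show ?thesis
    using Th_mono_iff[OF C Pts_convex_closed, of "Th C"] Th_mono_iff[OF Pts_convex_closed C, of "Th C"]
    by (intro X.C_ord_antisym) simp_all
qed

definition eta :: "'a modal_term set set \<Rightarrow> 'p set" where
  "eta = restrict Pts (points (P_obj (K_obj L)))"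

lemma continuous_eta: "continuous_map (topo (P_obj (K_obj L))) (topo (C_obj X)) eta"
proof (rule X.continuous_into_C)
  show "eta \<in> points (P_obj (K_obj L)) \<rightarrow> convex_closed_sets X"
    by (simp add: eta_def Pts_convex_closed)
  fix U assume "U \<in> clopen_upsets X"
  then obtain a where a: "a \<in> carrier L" "U = V a" using V_onto by blast
  have c: "modal_class L (Dia a) \<in> carrier (K_obj L)" "modal_class L (Box a) \<in> carrier (K_obj L)"
    using a by (simp_all add: L.K_carrier)
  show "\<exists>W. openin (topo (P_obj (K_obj L))) W \<and> closedin (topo (P_obj (K_obj L))) W \<and>
      (\<forall>x\<in>points (P_obj (K_obj L)). eta x \<inter> U \<noteq> {} \<longleftrightarrow> x \<in> W)"
    using K.prime_set_clopen[OF c(1)] a Dia_mem_iff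
    by (intro exI[of _ "prime_set (K_obj L) (modal_class L (Dia a))"])
      (simp add: eta_def prime_set_def K.points_P)
  show "\<exists>W. openin (topo (P_obj (K_obj L))) W \<and> closedin (topo (P_obj (K_obj L))) W \<and>
      (\<forall>x\<in>points (P_obj (K_obj L)). eta x \<subseteq> U \<longleftrightarrow> x \<in> W)"
    using K.prime_set_clopen[OF c(2)] a Box_mem_iff
    by (intro exI[of _ "prime_set (K_obj L) (modal_class L (Box a))"])
      (simp add: eta_def prime_set_def K.points_P)
qed

lemma priestley_C_obj: "priestley (C_obj X)"
proof
  have "C \<in> eta ` points (P_obj (K_obj L))" if "C \<in> convex_closed_sets X" for C
    using Pts_Th[OF that] prime_filter_Th[OF X.convex_closed_points[OF that]]
    by (intro image_eqI[of _ _ "Th C"]) (simp_all add: eta_def K.points_P)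
  then have "eta ` points (P_obj (K_obj L)) = points (C_obj X)"
    by (auto simp: X.points_C eta_def Pts_convex_closed)
  then have "compact_space (topo (C_obj X))"
    using image_compactin[OF K.compact_P[unfolded compact_space_def] continuous_eta]
    by (simp add: compact_space_def)
  then show "priestley_space (C_obj X)" by (rule X.priestley_C)
qed

sublocale CX: priestley "C_obj X" by (rule priestley_C_obj)

definition Mod :: "'a modal_term \<Rightarrow> 'p set set" where
  "Mod t = {C \<in> convex_closed_sets X. sat V C t}"

lemma Mod_simps:
  "Mod (Dia a) = dia_set X (V a)" "Mod (Box a) = box_set X (V a)"
  "Mod TBot = {}" "Mod TTop = points (C_obj X)"
  "Mod (TJoin s t) = Mod s \<union> Mod t" "Mod (TMeet s t) = Mod s \<inter> Mod t"
  by (auto simp: Mod_def dia_set_def box_set_def X.points_C)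

lemma Mod_upset: "t \<in> modal_terms L \<Longrightarrow> Mod t \<in> clopen_upsets (C_obj X)"
  by (induction t) (simp_all add: Mod_simps X.dia_set_upset X.box_set_upset V_up
      CX.clopen_upsets_empty CX.clopen_upsets_points CX.clopen_upsets_Un CX.clopen_upsets_Int)

text \<open>The inverse is the theory map. Its continuity is read off the generators: the preimage
  of a subbasic set given by the class of \<open>t\<close> is the clopen set \<open>Mod t\<close> or
  its complement.\<close>

lemma eta_iso: "eta \<in> PS_iso (P_obj (K_obj L)) (C_obj X)"
proof -
  define th where "th = restrict Th (convex_closed_sets X)"
  have prime: "prime_filter (K_obj L) (th C)" if "C \<in> convex_closed_sets X" for C
    using prime_filter_Th[OF X.convex_closed_points[OF that]] that by (simp add: th_def)
  have "(eta x, eta y) \<in> ord (C_obj X)" if "(x, y) \<in> ord (P_obj (K_obj L))" for x y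
  proof -
    have xy: "prime_filter (K_obj L) x" "prime_filter (K_obj L) y" "x \<subseteq> y"
      using that by (auto simp: P_obj_def)
    then show ?thesis
      using Th_mono_iff[OF Pts_convex_closed Pts_convex_closed, of x y]
      by (simp add: eta_def K.points_P Th_Pts)
  qed
  then have eta: "eta \<in> PS_hom (P_obj (K_obj L)) (C_obj X)"
    using continuous_eta by (simp add: PS_hom_def) (simp add: eta_def)
  have "continuous_map (topo (C_obj X)) (topo (P_obj (K_obj L))) th"
    unfolding P_obj_def[of "K_obj L"] ordered_space.simps
  proof (rule continuous_on_generated_topo)
    have "\<exists>A. A \<in> carrier (K_obj L)" by (rule exI) (rule K.top_closed)
    then show "th ` points (C_obj X) \<subseteq> \<Union> (\<Union>A\<in>carrier (K_obj L).
        {{x. prime_filter (K_obj L) x \<and> A \<in> x}, {x. prime_filter (K_obj L) x \<and> A \<notin> x}})"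
      using prime by (auto simp: X.points_C)
    fix U assume "U \<in> (\<Union>A\<in>carrier (K_obj L).
        {{x. prime_filter (K_obj L) x \<and> A \<in> x}, {x. prime_filter (K_obj L) x \<and> A \<notin> x}})"
    then obtain t where t: "t \<in> modal_terms L"
      and U: "U = {x. prime_filter (K_obj L) x \<and> modal_class L t \<in> x} \<or>
        U = {x. prime_filter (K_obj L) x \<and> modal_class L t \<notin> x}"
      by (auto simp: L.K_carrier)
    have "modal_class L t \<in> th C \<longleftrightarrow> sat V C t" if "C \<in> convex_closed_sets X" for C
      using Th_iff[OF X.convex_closed_points[OF that] t] that by (simp add: th_def)
    then have "th -` {x. prime_filter (K_obj L) x \<and> modal_class L t \<in> x} \<inter> points (C_obj X) = Mod t"
      "th -` {x. prime_filter (K_obj L) x \<and> modal_class L t \<notin> x} \<inter> points (C_obj X) = points (C_obj X) - Mod t"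
      using prime by (auto simp: X.points_C Mod_def)
    then show "openin (topo (C_obj X)) (th -` U \<inter> points (C_obj X))"
      using U CX.clopen_upsetD(1,2)[OF Mod_upset[OF t]] by (auto simp: closedin_def)
  qed
  moreover have "(th C, th D) \<in> ord (P_obj (K_obj L))" if CD: "(C, D) \<in> ord (C_obj X)" for C D
  proof -
    have c: "C \<in> convex_closed_sets X" "D \<in> convex_closed_sets X"
      using X.C_ord_convex[OF CD] by simp_all
    then have "th C \<subseteq> th D" using Th_mono_iff CD by (simp add: th_def)
    then show ?thesis using prime c by (simp add: P_obj_def)
  qed
  ultimately have th: "th \<in> PS_hom (C_obj X) (P_obj (K_obj L))"
    by (simp add: PS_hom_def X.points_C) (simp add: th_def)
  have "compose (points (P_obj (K_obj L))) th eta = restrict id (points (P_obj (K_obj L)))"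
    by (auto simp: fun_eq_iff compose_def eta_def th_def K.points_P Pts_convex_closed Th_Pts)
  moreover have "compose (points (C_obj X)) eta th = restrict id (points (C_obj X))"
    using prime Pts_Th by (auto simp: fun_eq_iff compose_def eta_def th_def K.points_P X.points_C)
  ultimately show ?thesis using eta th by (auto simp: PS_iso_def)
qed

definition eps :: "'a modal_term set \<Rightarrow> 'p set set" where
  "eps = (\<lambda>A\<in>carrier (K_obj L). {C \<in> convex_closed_sets X. A \<in> Th C})"

lemma eps_class:
  assumes "t \<in> modal_terms L"
  shows "eps (modal_class L t) = Mod t"
  using assms Th_iff[OF X.convex_closed_points] by (auto simp: eps_def Mod_def L.K_carrier)

text \<open>Completeness: a prime filter witnessing the failure of the inequality yields, through
  \<open>Pts\<close>, a closed convex set at which \<open>s\<close> holds and \<open>t\<close>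
  fails.\<close>

lemma Mod_subset_le:
  assumes st: "s \<in> modal_terms L" "t \<in> modal_terms L" and "Mod s \<subseteq> Mod t"
  shows "modal_class L s \<sqsubseteq>\<^bsub>K_obj L\<^esub> modal_class L t"
proof (rule ccontr)
  assume "\<not> modal_class L s \<sqsubseteq>\<^bsub>K_obj L\<^esub> modal_class L t"
  then obtain x where x: "prime_filter (K_obj L) x" "modal_class L s \<in> x" "modal_class L t \<notin> x"
    by (rule K.prime_filter_separates[rotated 2]) (simp_all add: st L.K_carrier)
  then have "Pts x \<in> Mod s" "Pts x \<notin> Mod t"
    using sat_Pts[OF x(1)] st by (simp_all add: Mod_def Pts_convex_closed)
  then show False using assms(3) by blast
qed

text \<open>The generators alone separate the order of \<open>C_obj X\<close>, as the Dia and Box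
  sets of clopen upsets are the interpretations of \<open>Dia a\<close> and
  \<open>Box a\<close>.\<close>

lemma Mod_onto: "Mod ` modal_terms L = clopen_upsets (C_obj X)"
proof (rule CX.separating_sublattice)
  show "Mod ` modal_terms L \<subseteq> clopen_upsets (C_obj X)" using Mod_upset by blast
  show "{} \<in> Mod ` modal_terms L" by (rule image_eqI[of _ _ TBot]) (simp_all add: Mod_simps)
  show "points (C_obj X) \<in> Mod ` modal_terms L"
    by (rule image_eqI[of _ _ TTop]) (simp_all add: Mod_simps)
next
  fix S T assume "S \<in> Mod ` modal_terms L" "T \<in> Mod ` modal_terms L"
  then obtain s t where st: "s \<in> modal_terms L" "t \<in> modal_terms L" "S = Mod s" "T = Mod t" by blast
  show "S \<union> T \<in> Mod ` modal_terms L"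
    by (rule image_eqI[of _ _ "TJoin s t"]) (simp_all add: Mod_simps st)
  show "S \<inter> T \<in> Mod ` modal_terms L"
    by (rule image_eqI[of _ _ "TMeet s t"]) (simp_all add: Mod_simps st)
next
  fix C D assume "C \<in> points (C_obj X)" "D \<in> points (C_obj X)" "(C, D) \<notin> ord (C_obj X)"
  then obtain U where "U \<in> clopen_upsets X" and
    U: "C \<in> dia_set X U \<and> D \<notin> dia_set X U \<or> C \<in> box_set X U \<and> D \<notin> box_set X U"
    using X.C_ord_separates by (auto simp: X.points_C)
  then obtain a where "a \<in> carrier L" "U = V a" using V_onto by blast
  then have "dia_set X U \<in> Mod ` modal_terms L" "box_set X U \<in> Mod ` modal_terms L"
    using Mod_simps(1,2)[of a] image_eqI[of _ Mod "Dia a"] image_eqI[of _ Mod "Box a"] by simp_all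
  then show "\<exists>U\<in>Mod ` modal_terms L. C \<in> U \<and> D \<notin> U" using U by blast
qed

lemma eps_iso: "eps \<in> DL_iso (K_obj L) (CU_obj (C_obj X))"
proof (rule DL_iso_bij[OF L.K_DL CX.CU_DL])
  show "eps \<in> DL_hom (K_obj L) (CU_obj (C_obj X))"
  proof (rule DL_homI[OF L.K_DL CX.CU_DL])
    show "eps \<in> carrier (K_obj L) \<rightarrow>\<^sub>E carrier (CU_obj (C_obj X))"
    proof (rule PiE_I)
      fix A assume "A \<in> carrier (K_obj L)"
      then show "eps A \<in> carrier (CU_obj (C_obj X))"
        by (auto simp: L.K_carrier CX.CU_carrier eps_class Mod_upset)
    qed (simp add: eps_def)
  next
    fix A B assume "A \<in> carrier (K_obj L)" "B \<in> carrier (K_obj L)"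
    then obtain s t where "s \<in> modal_terms L" "t \<in> modal_terms L" "A = modal_class L s" "B = modal_class L t"
      by (auto simp: L.K_carrier)
    then show "eps (A \<squnion>\<^bsub>K_obj L\<^esub> B) = eps A \<squnion>\<^bsub>CU_obj (C_obj X)\<^esub> eps B"
      "eps (A \<sqinter>\<^bsub>K_obj L\<^esub> B) = eps A \<sqinter>\<^bsub>CU_obj (C_obj X)\<^esub> eps B"
      by (simp_all add: L.K_join L.K_meet eps_class CX.CU_join CX.CU_meet Mod_upset Mod_simps)
  next
    show "eps \<bottom>\<^bsub>K_obj L\<^esub> = \<bottom>\<^bsub>CU_obj (C_obj X)\<^esub>" "eps \<top>\<^bsub>K_obj L\<^esub> = \<top>\<^bsub>CU_obj (C_obj X)\<^esub>"
      by (simp_all add: L.K_bottom L.K_top CX.CU_bottom CX.CU_top eps_class Mod_simps)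
  qed
  have "inj_on eps (carrier (K_obj L))"
  proof (rule inj_onI)
    fix A B assume AB: "A \<in> carrier (K_obj L)" "B \<in> carrier (K_obj L)" "eps A = eps B"
    then obtain s t where st: "s \<in> modal_terms L" "t \<in> modal_terms L" "A = modal_class L s" "B = modal_class L t"
      by (auto simp: L.K_carrier)
    then have "Mod s = Mod t" using AB(3) by (simp add: eps_class)
    then have "A \<sqsubseteq>\<^bsub>K_obj L\<^esub> B" "B \<sqsubseteq>\<^bsub>K_obj L\<^esub> A" using Mod_subset_le st by simp_all
    then show "A = B" using K.le_antisym AB by blast
  qed
  moreover have "eps ` carrier (K_obj L) = Mod ` modal_terms L"
    unfolding L.K_carrier image_image by (rule image_cong) (simp_all add: eps_class)
  ultimately show "bij_betw eps (carrier (K_obj L)) (carrier (CU_obj (C_obj X)))"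
    by (simp add: bij_betw_def Mod_onto CX.CU_carrier)
qed

end

section \<open>Naturality of both isomorphisms\<close>

text \<open>Under the two representations \<open>f\<close> is inverse image along \<open>h\<close>,
  which therefore points the opposite way. Instances are a lattice map with its
  \<open>P_map\<close>, and a map of spaces with its \<open>CU_map\<close>.\<close>

locale representation_square =
  L: DL_representation L X V + M: DL_representation M Y W
  for L :: "'a gorder" and X :: "'p ordered_space" and V
    and M :: "'b gorder" and Y :: "'q ordered_space" and W +
  fixes f h
  assumes f: "f \<in> DL_hom L M" and h: "h \<in> PS_hom Y X"
    and square: "a \<in> carrier L \<Longrightarrow> W (f a) = {y \<in> points Y. h y \<in> V a}"
begin

text \<open>The hull in \<open>C_map\<close> is invisible to clopen upsets, and by
  \<open>square\<close> the preimage of \<open>V a\<close> under \<open>h\<close> is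
  \<open>W (f a)\<close>. Both naturality squares are consequences.\<close>

lemma sat_C_map:
  assumes C: "C \<in> convex_closed_sets Y" and "t \<in> modal_terms L"
  shows "sat V (C_map Y X h C) t \<longleftrightarrow> sat W C (map_modal_term f t)"
  using assms(2)
proof (induction t)
  case (Dia a)
  then show ?case
    using C_map_dia[OF M.X.priestley_axioms L.X.priestley_axioms h C L.V_up[of a]] by (simp add: square)
next
  case (Box a)
  then show ?case
    using C_map_box[OF M.X.priestley_axioms L.X.priestley_axioms h C L.V_up[of a]] by (simp add: square)
qed simp_all

lemmas C_map_closed = C_map_convex_closed[OF M.X.priestley_axioms L.X.priestley_axioms h]
lemmas K_map_class' = K_map_class[OF L.L.DL_object_axioms M.L.DL_object_axioms f]

text \<open>By \<open>sat_C_map\<close>, the filter pulled back along \<open>K_map L M f\<close> is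
  the theory of the image of \<open>M.Pts x\<close> under \<open>C_map Y X h\<close>; that image is
  closed and convex, so \<open>L.Pts\<close> recovers it.\<close>

lemma eta_natural:
  "compose (points (P_obj (K_obj M))) L.eta (P_map (K_obj L) (K_obj M) (K_map L M f)) =
   compose (points (P_obj (K_obj M))) (C_map Y X h) M.eta"
proof (rule ext)
  fix x
  show "compose (points (P_obj (K_obj M))) L.eta (P_map (K_obj L) (K_obj M) (K_map L M f)) x =
    compose (points (P_obj (K_obj M))) (C_map Y X h) M.eta x"
  proof (cases "x \<in> points (P_obj (K_obj M))")
    case True
    then have x: "prime_filter (K_obj M) x" by (simp add: M.K.points_P)
    let ?D = "C_map Y X h (M.Pts x)"
    let ?y = "{A \<in> carrier (K_obj L). K_map L M f A \<in> x}"
    have D: "?D \<in> convex_closed_sets X" by (rule C_map_closed[OF M.Pts_convex_closed])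
    have y: "prime_filter (K_obj L) ?y"
      by (rule P_map_prime[OF L.L.K_DL M.L.K_DL
            K_map_hom[OF L.L.DL_object_axioms M.L.DL_object_axioms f] x])
    have "modal_class L t \<in> ?y \<longleftrightarrow> sat V ?D t" if t: "t \<in> modal_terms L" for t
      using t sat_C_map[OF M.Pts_convex_closed t] M.sat_Pts[OF x modal_terms_map[OF f t]]
      by (simp add: K_map_class' L.L.K_carrier)
    then have "?y = L.Th ?D" by (auto simp: L.Th_def L.L.K_carrier)
    then have "L.Pts ?y = ?D" using L.Pts_Th[OF D] by simp
    then show ?thesis
      using True x y by (simp add: compose_def P_map_def L.eta_def M.eta_def L.K.points_P)
  qed (simp add: compose_def)
qed

lemma eps_natural:
  "compose (carrier (K_obj L)) M.eps (K_map L M f) =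
   compose (carrier (K_obj L)) (CU_map (C_obj Y) (C_obj X) (C_map Y X h)) L.eps"
proof (rule ext)
  fix A
  show "compose (carrier (K_obj L)) M.eps (K_map L M f) A =
   compose (carrier (K_obj L)) (CU_map (C_obj Y) (C_obj X) (C_map Y X h)) L.eps A"
  proof (cases "A \<in> carrier (K_obj L)")
    case True
    then obtain t where t: "t \<in> modal_terms L" "A = modal_class L t" by (auto simp: L.L.K_carrier)
    have "M.Mod (map_modal_term f t) = {C \<in> points (C_obj Y). C_map Y X h C \<in> L.Mod t}"
      using sat_C_map[OF _ t(1)] C_map_closed by (auto simp: M.Mod_def L.Mod_def M.X.points_C)
    then show ?thesis
      using True t modal_terms_map[OF f t(1)] L.Mod_upset[OF t(1)]
      by (simp add: compose_def K_map_class' M.eps_class L.eps_class CU_map_def)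
  qed (simp add: compose_def)
qed

end

text \<open>Order reflection is separation by prime filters; surjectivity holds because the sets
  \<open>prime_set L a\<close> form a sublattice that separates the inclusion order of prime
  filters.\<close>

lemma (in DL_object) prime_set_representation: "DL_representation L (P_obj L) (prime_set L)"
proof -
  interpret P: priestley "P_obj L" by standard (rule priestley_P)
  have join: "prime_set L (a \<squnion> b) = prime_set L a \<union> prime_set L b"
    and meet: "prime_set L (a \<sqinter> b) = prime_set L a \<inter> prime_set L b"
    if "a \<in> carrier L" "b \<in> carrier L" for a b
    using that prime_filter_join_iff prime_filter_meet_iff by (auto simp: prime_set_def)
  have bot: "prime_set L \<bottom> = {}" and top: "prime_set L \<top> = points (P_obj L)"
    using prime_filter_bottom prime_filter_top by (auto simp: prime_set_def points_P)
  have onto: "prime_set L ` carrier L = clopen_upsets (P_obj L)"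
  proof (rule P.separating_sublattice)
    show "prime_set L ` carrier L \<subseteq> clopen_upsets (P_obj L)" using prime_set_upset by blast
    show "{} \<in> prime_set L ` carrier L" "points (P_obj L) \<in> prime_set L ` carrier L"
      using imageI[OF bottom_closed, of "prime_set L"] imageI[OF top_closed, of "prime_set L"] bot top
      by simp_all
  next
    fix U V assume "U \<in> prime_set L ` carrier L" "V \<in> prime_set L ` carrier L"
    then obtain a b where ab: "a \<in> carrier L" "b \<in> carrier L" "U = prime_set L a" "V = prime_set L b"
      by (elim imageE)
    show "U \<union> V \<in> prime_set L ` carrier L"
      using ab join[of a b] by (intro image_eqI[of _ _ "a \<squnion> b"]) simp_all
    show "U \<inter> V \<in> prime_set L ` carrier L"
      using ab meet[of a b] by (intro image_eqI[of _ _ "a \<sqinter> b"]) simp_all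
  next
    fix x y assume "x \<in> points (P_obj L)" "y \<in> points (P_obj L)" "(x, y) \<notin> ord (P_obj L)"
    then have xy: "prime_filter L x" "prime_filter L y" "\<not> x \<subseteq> y"
      by (auto simp: points_P) (auto simp: P_obj_def)
    then obtain a where "a \<in> x" "a \<notin> y" by blast
    moreover have "a \<in> carrier L" using prime_filter_subset[OF xy(1)] calculation by blast
    ultimately show "\<exists>U\<in>prime_set L ` carrier L. x \<in> U \<and> y \<notin> U"
      using xy by (intro bexI[of _ "prime_set L a"]) (auto simp: prime_set_def)
  qed
  show ?thesis
  proof unfold_locales
    show "a \<sqsubseteq> b" if "a \<in> carrier L" "b \<in> carrier L" "prime_set L a \<subseteq> prime_set L b" for a b
      using prime_filter_separates[OF that(1,2)] that(3) by (auto simp: prime_set_def)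
    show "\<exists>a\<in>carrier L. U = prime_set L a" if "U \<in> clopen_upsets (P_obj L)" for U
      using that onto by blast
  qed (simp_all add: prime_set_upset join meet bot top)
qed

lemma (in priestley) CU_representation: "DL_representation (CU_obj X) X (\<lambda>U. U)"
proof -
  interpret CU: DL_object "CU_obj X" by (rule CU_DL)
  show ?thesis
    by unfold_locales (simp_all add: CU_carrier CU_join CU_meet CU_bottom CU_top CU_le)
qed

section \<open>The four composite functors and the two natural isomorphisms\<close>

lemma obj_DL: "L \<in> obj DL \<longleftrightarrow> DL_object L"
  and und_DL: "und DL = carrier" and hom_DL: "hom DL = DL_hom"
  by (simp_all add: DL_def DL_object_def)

lemma obj_PS: "X \<in> obj PS \<longleftrightarrow> priestley X"
  and und_PS: "und PS = points" and hom_PS: "hom PS = PS_hom"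
  by (simp_all add: PS_def priestley_def)

lemmas category_simps = obj_DL und_DL hom_DL obj_PS und_PS hom_PS

lemma priestley_P_obj: "DL_object L \<Longrightarrow> priestley (P_obj L)"
  using DL_object.priestley_P by (simp add: priestley_def)

lemma P_square:
  assumes "DL_object L" "DL_object M" "f \<in> DL_hom L M"
  shows "representation_square L (P_obj L) (prime_set L) M (P_obj M) (prime_set M) f (P_map L M f)"
proof -
  interpret L: DL_object L by fact
  interpret M: DL_object M by fact
  show ?thesis
  proof (intro representation_square.intro representation_square_axioms.intro
        L.prime_set_representation M.prime_set_representation assms(3) P_map_hom[OF assms])
    fix a assume "a \<in> carrier L"
    then show "prime_set M (f a) = {y \<in> points (P_obj M). P_map L M f y \<in> prime_set L a}"
      using P_map_prime[OF assms] by (auto simp: prime_set_def M.points_P P_map_def)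
  qed
qed

lemma CU_square:
  assumes "priestley X" "priestley Y" "g \<in> PS_hom X Y"
  shows "representation_square (CU_obj Y) Y (\<lambda>U. U) (CU_obj X) X (\<lambda>U. U) (CU_map X Y g) g"
proof -
  interpret X: priestley X by fact
  interpret Y: priestley Y by fact
  show ?thesis
    by (intro representation_square.intro representation_square_axioms.intro
        X.CU_representation Y.CU_representation assms(3) CU_map_hom[OF assms])
      (simp add: CU_map_def Y.CU_carrier)
qed

lemma contravariant_functor_PK:
  "contravariant_functor DL PS (\<lambda>L. P_obj (K_obj L)) (\<lambda>L M f. P_map (K_obj L) (K_obj M) (K_map L M f))"
  unfolding contravariant_functor_def Ball_def category_simps
  by (auto simp: priestley_P_obj DL_object.K_DL P_map_hom K_map_hom K_map_id P_map_id
      K_map_compose P_map_compose)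

text \<open>That the values are Priestley spaces is the nontrivial clause: it comes from
  \<open>priestley_C_obj\<close> for the representation of \<open>L\<close> by prime
  filters.\<close>

lemma contravariant_functor_CP:
  "contravariant_functor DL PS (\<lambda>L. C_obj (P_obj L)) (\<lambda>L M f. C_map (P_obj M) (P_obj L) (P_map L M f))"
  unfolding contravariant_functor_def Ball_def category_simps
  by (auto simp: priestley_P_obj C_map_hom P_map_hom P_map_id C_map_id P_map_compose C_map_compose
      DL_representation.priestley_C_obj[OF DL_object.prime_set_representation])

lemma contravariant_functor_KCU:
  "contravariant_functor PS DL (\<lambda>X. K_obj (CU_obj X)) (\<lambda>X Y g. K_map (CU_obj Y) (CU_obj X) (CU_map X Y g))"
  unfolding contravariant_functor_def Ball_def category_simps
  by (auto simp: priestley.CU_DL DL_object.K_DL CU_map_hom K_map_hom CU_map_id K_map_id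
      CU_map_compose K_map_compose)

lemma contravariant_functor_CUC:
  "contravariant_functor PS DL (\<lambda>X. CU_obj (C_obj X)) (\<lambda>X Y g. CU_map (C_obj X) (C_obj Y) (C_map X Y g))"
  unfolding contravariant_functor_def Ball_def category_simps
  by (auto simp: priestley.CU_DL CU_map_hom C_map_hom CU_map_id C_map_id CU_map_compose C_map_compose
      DL_representation.priestley_C_obj[OF priestley.CU_representation])

theorem theorem5p3:
  shows "contravariant_naturally_isomorphic
           (DL :: ('a gorder, 'a) concrete_category) PS PS PS_iso
           (\<lambda>L. P_obj (K_obj L))
           (\<lambda>L M f. P_map (K_obj L) (K_obj M) (K_map L M f))
           (\<lambda>L. C_obj (P_obj L))
           (\<lambda>L M f. C_map (P_obj M) (P_obj L) (P_map L M f)) \<and>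
         contravariant_naturally_isomorphic
           (PS :: ('b ordered_space, 'b) concrete_category) DL DL DL_iso
           (\<lambda>X. K_obj (CU_obj X))
           (\<lambda>X Y g. K_map (CU_obj Y) (CU_obj X) (CU_map X Y g))
           (\<lambda>X. CU_obj (C_obj X))
           (\<lambda>X Y g. CU_map (C_obj X) (C_obj Y) (C_map X Y g))"
proof
  let ?eta = "\<lambda>L :: 'a gorder. DL_representation.eta L (P_obj L) (prime_set L)"
  have "?eta L \<in> PS_iso (P_obj (K_obj L)) (C_obj (P_obj L))" if "DL_object L" for L :: "'a gorder"
    by (rule DL_representation.eta_iso[OF DL_object.prime_set_representation[OF that]])
  moreover note representation_square.eta_natural[OF P_square]
  ultimately show "contravariant_naturally_isomorphic
           (DL :: ('a gorder, 'a) concrete_category) PS PS PS_iso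
           (\<lambda>L. P_obj (K_obj L))
           (\<lambda>L M f. P_map (K_obj L) (K_obj M) (K_map L M f))
           (\<lambda>L. C_obj (P_obj L))
           (\<lambda>L M f. C_map (P_obj M) (P_obj L) (P_map L M f))"
    unfolding contravariant_naturally_isomorphic_def Ball_def category_simps
    by (intro conjI contravariant_functor_PK contravariant_functor_CP exI[of _ ?eta] allI impI) blast+
next
  let ?eps = "\<lambda>X :: 'b ordered_space. DL_representation.eps (CU_obj X) X (\<lambda>U. U)"
  have "?eps X \<in> DL_iso (K_obj (CU_obj X)) (CU_obj (C_obj X))" if "priestley X" for X :: "'b ordered_space"
    by (rule DL_representation.eps_iso[OF priestley.CU_representation[OF that]])
  moreover note representation_square.eps_natural[OF CU_square]
  ultimately show "contravariant_naturally_isomorphic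
           (PS :: ('b ordered_space, 'b) concrete_category) DL DL DL_iso
           (\<lambda>X. K_obj (CU_obj X))
           (\<lambda>X Y g. K_map (CU_obj Y) (CU_obj X) (CU_map X Y g))
           (\<lambda>X. CU_obj (C_obj X))
           (\<lambda>X Y g. CU_map (C_obj X) (C_obj Y) (C_map X Y g))"
    unfolding contravariant_naturally_isomorphic_def Ball_def category_simps
    by (intro conjI contravariant_functor_KCU contravariant_functor_CUC exI[of _ ?eps] allI impI) blast+
qed

end
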